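(* Let $\Gamma$ be an additive subgroup of $\mathbb{R}$, let $E,F$ be finite disjoint sets, and let $\mathsf{A}$ be a valuated bimatroid on rows $E$ and columns $F$ with minor valuation function $\mu_{\mathsf{A}}\colon\binom{E}{\ast}\times\binom{F}{\ast}\to\overline{\Gamma}$. Fix $0<q\leq1$ and set $$R_k(\mathsf{A}):=\sum_{(I,J)\in\binom{E}{k}\times\binom{F}{k}} q^{\mu_{\mathsf{A}}(I,J)}\qquad(k\geq0),$$ with the convention $q^\infty=0$. Then for every integer $N\geq\min\{|E|,|F|\}$ and every $k\ge 1$, $$\frac{R_k(\mathsf{A})^2}{\binom{N}{k}^2}\ \geq\ \frac{R_{k+1}(\mathsf{A})}{\binom{N}{k+1}}\cdot\frac{R_{k-1}(\mathsf{A})}{\binom{N}{k-1}},$$ i.e. the sequence $(R_k(\mathsf{A}))_k$ is ultra log-concave.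
   Context: $\overline{\Gamma}=\Gamma\sqcup\{\infty\}$ with $\infty$ larger than every element of $\Gamma$. $\binom{E}{k}$ is the set of $k$-element subsets of $E$; $\binom{E}{\ast}\times\binom{F}{\ast}$ is the set of pairs $(I,J)$ with $I\subseteq E$, $J\subseteq F$, $|I|=|J|$. A valuated matroid of rank $r$ on a finite set $X$ is a map $\nu\colon\binom{X}{r}\to\overline{\Gamma}$, not identically $\infty$, such that for all $S,T\in\binom{X}{r}$ and $s\in S- T$ there is $t\in T- S$ with $\nu(S)+\nu(T)\geq\nu(S-\{s\}\cup\{t\})+\nu(T-\{t\}\cup\{s\})$. A valuated bimatroid on rows $E$ and columns $F$ is a map $\mu_{\mathsf{A}}\colon\binom{E}{\ast}\times\binom{F}{\ast}\to\overline{\Gamma}$ such that the map $\nu_{\widehat{\mathsf{A}}}\colon\binom{E\sqcup F}{|E|}\to\overline{\Gamma}$, $\nu_{\widehat{\mathsf{A}}}(S)=\mu_{\mathsf{A}}(E- S,\,S\cap F)$, is a valuated matroid of rank $|E|$ on $E\sqcup F$ with $\nu_{\widehat{\mathsf{A}}}(E)=0$. Binomial coefficients $\binom{N}{j}$ with $j>N$ are $0$ (only $N$, $k$ with nonzero denominators are meant). *)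

theory Defs
  imports Complex_Main "HOL-Library.Extended_Real"
begin

definition additive_subgroup :: "real set \<Rightarrow> bool" where
  "additive_subgroup G \<longleftrightarrow> 0 \<in> G \<and> (\<forall>x\<in>G. \<forall>y\<in>G. x + y \<in> G) \<and> (\<forall>x\<in>G. - x \<in> G)"

definition Gbar :: "real set \<Rightarrow> ereal set" where
  "Gbar G = ereal ` G \<union> {\<infinity>}"

definition valuated_matroid :: "real set \<Rightarrow> 'a set \<Rightarrow> nat \<Rightarrow> ('a set \<Rightarrow> ereal) \<Rightarrow> bool" where
  "valuated_matroid G X r \<nu> \<longleftrightarrow>
     (\<forall>S. S \<subseteq> X \<and> card S = r \<longrightarrow> \<nu> S \<in> Gbar G) \<and>
     (\<exists>S. S \<subseteq> X \<and> card S = r \<and> \<nu> S \<noteq> \<infinity>) \<and>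
     (\<forall>S T s. S \<subseteq> X \<and> card S = r \<and> T \<subseteq> X \<and> card T = r \<and> s \<in> S - T \<longrightarrow>
        (\<exists>t \<in> T - S. \<nu> S + \<nu> T \<ge> \<nu> (S - {s} \<union> {t}) + \<nu> (T - {t} \<union> {s})))"

definition valuated_bimatroid :: "real set \<Rightarrow> 'a set \<Rightarrow> 'a set \<Rightarrow> ('a set \<Rightarrow> 'a set \<Rightarrow> ereal) \<Rightarrow> bool" where
  "valuated_bimatroid G E F \<mu> \<longleftrightarrow>
     valuated_matroid G (E \<union> F) (card E) (\<lambda>S. \<mu> (E - S) (S \<inter> F)) \<and>
     (\<lambda>S. \<mu> (E - S) (S \<inter> F)) E = 0"

definition qpow :: "real \<Rightarrow> ereal \<Rightarrow> real" where
  "qpow q v = (if v = \<infinity> then 0 else q powr (real_of_ereal v))"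

definition R :: "real \<Rightarrow> 'a set \<Rightarrow> 'a set \<Rightarrow> ('a set \<Rightarrow> 'a set \<Rightarrow> ereal) \<Rightarrow> nat \<Rightarrow> real" where
  "R q E F \<mu> k = (\<Sum>(I, J) \<in> {(I, J). I \<subseteq> E \<and> J \<subseteq> F \<and> card I = k \<and> card J = k}. qpow q (\<mu> I J))"

end

theory Submission
  imports Defs "HOL-Analysis.Analysis"
begin

text \<open>
  The weights \<open>p S = q powr \<nu> S\<close> of the bases satisfy a multiplicative exchange inequality, and the
  polarisation of the multiaffine polynomial \<open>\<Sum>S. p S * (\<Prod>i\<in>S. x i)\<close> then satisfies an
  Alexandrov--Fenchel inequality; that is, the polynomial is Lorentzian. This is an induction on the
  rank. In rank two, the exchange inequality says that \<open>p {i, j} / (p {r, i} * p {r, j})\<close> is an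
  ultrametric, hence conditionally negative definite. In higher rank, let \<open>H\<close> be the symmetric form
  obtained by fixing positive vectors \<open>u, u\<^sub>2, \<dots>\<close> in all but two slots. Writing \<open>H\<close> as the sum of
  \<open>u i * H\<^sub>i\<close>, with \<open>H\<^sub>i\<close> coming from the contraction by \<open>i\<close>, the inequalities for the
  \<open>H\<^sub>i\<close> show that every positive eigenvalue of \<open>H\<close>, relative to the diagonal matrix \<open>D\<close> with
  \<open>H u = D u\<close>, is at least 1, while 1 is the largest eigenvalue and is simple because the matroid
  exchange property makes \<open>H\<close> irreducible.

  Evaluating the inequality at copies of the indicator vectors of \<open>E\<close> and \<open>F\<close> gives ultra
  log-concavity with parameter \<open>card E\<close>; the dual matroid gives the parameter \<open>card F\<close>, and the
  inequality weakens as \<open>N\<close> grows.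
\<close>

section \<open>Quadratic forms that are nonpositive on a hyperplane\<close>

text \<open>
  Merging a closest pair \<open>a\<close>, \<open>b\<close> does not decrease the form, provided the diagonal is allowed to be
  positive: the instance \<open>i = j\<close> of the ultrametric inequality bounds it by the other entries.
\<close>

lemma ultrametric_sum_nonpos:
  fixes g :: "'a \<Rightarrow> 'a \<Rightarrow> real"
  assumes "finite A" "\<And>i j. i \<in> A \<Longrightarrow> j \<in> A \<Longrightarrow> g i j = g j i"
    and "\<And>i j k. i \<in> A \<Longrightarrow> j \<in> A \<Longrightarrow> k \<in> A \<Longrightarrow> g i j \<le> max (g i k) (g j k)"
    and "(\<Sum>i\<in>A. x i) = 0"
  shows "(\<Sum>i\<in>A. \<Sum>j\<in>A. g i j * x i * x j) \<le> 0"
  using assms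
proof (induction "card A" arbitrary: A g x rule: less_induct)
  case less
  note sym = less.prems(2) and um = less.prems(3)
  show ?case
  proof (cases "\<exists>a\<in>A. \<exists>b\<in>A. a \<noteq> b")
    case False
    then have "A = {} \<or> (\<exists>a. A = {a})" by blast
    then show ?thesis using less.prems(4) by auto
  next
    case True
    define P where "P = {(a, b). a \<in> A \<and> b \<in> A \<and> a \<noteq> b}"
    have "finite P" unfolding P_def
      by (rule finite_subset[of _ "A \<times> A"]) (use less.prems(1) in auto)
    moreover have "P \<noteq> {}" using True by (auto simp: P_def)
    ultimately have "\<exists>z\<in>P. \<forall>y\<in>P. case_prod g z \<le> case_prod g y"
      by (metis (mono_tags, lifting) arg_min_if_finite(1) arg_min_least)
    then obtain a b where ab: "a \<in> A" "b \<in> A" "a \<noteq> b"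
      and min: "\<And>i j. i \<in> A \<Longrightarrow> j \<in> A \<Longrightarrow> i \<noteq> j \<Longrightarrow> g a b \<le> g i j"
      by (fastforce simp: P_def)
    define C where "C = A - {a, b}"
    have C: "finite C" "a \<notin> C" "b \<notin> C" "A = insert a (insert b C)"
      using ab less.prems(1) by (auto simp: C_def)
    \<comment> \<open>Minimality of \<open>g a b\<close> and the ultrametric inequality put
      \<open>a\<close> and \<open>b\<close> at the same distance from every third point, so merging
      them changes only the entries among \<open>a\<close> and \<open>b\<close>.\<close>
    have eq: "g b k = g a k" "g k b = g a k" "g k a = g a k" if "k \<in> C" for k
    proof -
      have k: "k \<in> A" "k \<noteq> a" "k \<noteq> b" using that by (auto simp: C_def)
      have "g a k \<le> g k b" using um[of a k b] min[of k b] k ab by auto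
      moreover have "g b k \<le> g k a"
        using um[of b k a] min[of k a] sym[of b a] k ab by auto
      ultimately show "g b k = g a k" "g k b = g a k" "g k a = g a k"
        using sym k ab by force+
    qed
    have diag: "g a a \<le> g a b" "g b b \<le> g a b"
      using um[of a a b] um[of b b a] sym[of b a] ab by auto
    \<comment> \<open>From here on \<open>a\<close> stands for the merged pair. Its diagonal entry
      \<open>g a b\<close> bounds both \<open>g a a\<close> and \<open>g b b\<close>, and its weight
      \<open>x a + x b\<close> keeps the total at zero.\<close>
    define g' where "g' = (\<lambda>i j. if i = a \<and> j = a then g a b else g i j)"
    define x' where "x' = x(a := x a + x b)"
    have le: "(\<Sum>i\<in>insert a C. \<Sum>j\<in>insert a C. g' i j * x' i * x' j) \<le> 0"
    proof (rule less.hyps)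
      show "card (insert a C) < card A" using C ab by simp
      show "finite (insert a C)" using C by simp
      show "g' i j = g' j i" if "i \<in> insert a C" "j \<in> insert a C" for i j
        using that sym C by (auto simp: g'_def)
      show "g' i j \<le> max (g' i k) (g' j k)"
        if "i \<in> insert a C" "j \<in> insert a C" "k \<in> insert a C" for i j k
      proof -
        have A: "i \<in> A" "j \<in> A" "k \<in> A" using that C by auto
        have ge: "g s t \<le> g' s t" for s t using diag by (auto simp: g'_def)
        show ?thesis
        proof (cases "i = a \<and> j = a")
          case True
          then show ?thesis using min[of a k] A by (auto simp: g'_def)
        next
          case False
          then have "g' i j = g i j" by (auto simp: g'_def)
          then show ?thesis using um[OF A] ge[of i k] ge[of j k] by auto
        qed
      qed
      have "(\<Sum>i\<in>C. x' i) = (\<Sum>i\<in>C. x i)"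
        using C by (intro sum.cong) (auto simp: x'_def)
      then show "(\<Sum>i\<in>insert a C. x' i) = 0"
        using less.prems(4) C ab by (simp add: x'_def)
    qed
    define Q where "Q = (\<Sum>i\<in>C. \<Sum>j\<in>C. g i j * x i * x j)"
    define l where "l = (\<Sum>k\<in>C. g a k * x k)"
    have Q': "(\<Sum>i\<in>C. \<Sum>j\<in>C. g' i j * x' i * x' j) = Q"
      unfolding Q_def using C by (intro sum.cong) (auto simp: g'_def x'_def)
    have l': "(\<Sum>k\<in>C. g' a k * x' a * x' k) = (x a + x b) * l"
      "(\<Sum>k\<in>C. g' k a * x' k * x' a) = (x a + x b) * l"
      "(\<Sum>k\<in>C. g a k * x a * x k) = x a * l"
      "(\<Sum>k\<in>C. g b k * x b * x k) = x b * l"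
      "(\<Sum>k\<in>C. g k a * x k * x a) = x a * l"
      "(\<Sum>k\<in>C. g k b * x k * x b) = x b * l"
      unfolding l_def sum_distrib_left
      using C eq by (auto intro!: sum.cong simp: g'_def x'_def)
    have s': "(\<Sum>i\<in>insert a C. \<Sum>j\<in>insert a C. g' i j * x' i * x' j)
        = g a b * (x a + x b)\<^sup>2 + 2 * (x a + x b) * l + Q"
      using C by (simp add: sum.distrib Q' l') (simp add: g'_def x'_def power2_eq_square)
    have s: "(\<Sum>i\<in>A. \<Sum>j\<in>A. g i j * x i * x j)
        = g a a * (x a)\<^sup>2 + g b b * (x b)\<^sup>2 + 2 * g a b * x a * x b + 2 * (x a + x b) * l + Q"
      unfolding C(4) using C(1-3) ab sym[of b a]
      by (simp add: sum.distrib Q_def[symmetric] l') (simp add: algebra_simps power2_eq_square)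
    have "g a a * (x a)\<^sup>2 \<le> g a b * (x a)\<^sup>2" "g b b * (x b)\<^sup>2 \<le> g a b * (x b)\<^sup>2"
      using diag by (auto intro: mult_right_mono)
    then show ?thesis using le unfolding s s' by (simp add: power2_sum algebra_simps)
  qed
qed

text \<open>
  If the conclusion failed, \<open>B\<close> would be positive definite on the plane spanned by \<open>v\<close> and \<open>w\<close>,
  which meets the hyperplane \<open>B x e = 0\<close>.
\<close>

lemma reverse_cauchy_schwarz:
  fixes B :: "('a \<Rightarrow> real) \<Rightarrow> ('a \<Rightarrow> real) \<Rightarrow> real"
  assumes sym: "\<And>x y. B x y = B y x"
    and lin: "\<And>a b x y z. B (\<lambda>i. a * x i + b * y i) z = a * B x z + b * B y z"
    and neg: "\<And>x. B x e = 0 \<Longrightarrow> B x x \<le> 0"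
    and w: "0 \<le> B w w"
  shows "B v v * B w w \<le> (B v w)\<^sup>2"
proof (cases "B w w = 0")
  case True then show ?thesis by simp
next
  case False
  with w have w: "0 < B w w" by simp
  have lin2: "B z (\<lambda>i. a * x i + b * y i) = a * B z x + b * B z y" for a b x y z
    using lin[of a x b y z] sym by metis
  \<comment> \<open>The part of \<open>v\<close> that is \<open>B\<close>-orthogonal to
    \<open>w\<close>, scaled by \<open>B w w\<close> to avoid a division.\<close>
  define y where "y = (\<lambda>i. B w w * v i + (- B v w) * w i)"
  have yw: "B y w = 0" unfolding y_def lin by simp
  then have wy: "B w y = 0" using sym by metis
  have "B y y = B w w * (B w w * B v v - (B v w)\<^sup>2)"
    unfolding y_def lin lin2 using sym[of w v] by (simp add: algebra_simps power2_eq_square)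
  moreover have "B y y \<le> 0"
  proof (rule ccontr)
    assume "\<not> B y y \<le> 0"
    then have yy: "0 < B y y" by simp
    have we: "B w e \<noteq> 0" using neg[of w] w by auto
    \<comment> \<open>A combination of \<open>y\<close> and \<open>w\<close> chosen to lie in the
      hyperplane of \<open>e\<close>. The mixed terms of \<open>B x x\<close> vanish because
      \<open>B y w = 0\<close>, so \<open>B x x\<close> would be positive.\<close>
    define x where "x = (\<lambda>i. B w e * y i + (- B y e) * w i)"
    have "B x e = 0" unfolding x_def lin by simp
    moreover have "B x x = (B w e)\<^sup>2 * B y y + (B y e)\<^sup>2 * B w w"
      unfolding x_def lin lin2 yw wy by (simp add: power2_eq_square)
    moreover have "0 < (B w e)\<^sup>2 * B y y + (B y e)\<^sup>2 * B w w"
      using we yy w by (simp add: add_pos_nonneg)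
    ultimately show False using neg[of x] by simp
  qed
  ultimately have "B w w * B v v - (B v w)\<^sup>2 \<le> 0"
    using w by (metis mult_le_0_iff not_less)
  then show ?thesis by (simp add: mult.commute)
qed

text \<open>With one of the four indices equal to \<open>r\<close>, dividing by entries of row
  \<open>r\<close> turns the four-point condition into an ultrametric inequality on the support
  \<open>A\<close> of that row. An index outside \<open>A\<close> has a row proportional to row
  \<open>r\<close>, hence orthogonal to \<open>v\<close>, and drops out of the form.\<close>

lemma four_point_nonpos:
  fixes H :: "'a \<Rightarrow> 'a \<Rightarrow> real"
  assumes X: "finite X" and sym: "\<And>i j. i \<in> X \<Longrightarrow> j \<in> X \<Longrightarrow> H i j = H j i"
    and nn: "\<And>i j. i \<in> X \<Longrightarrow> j \<in> X \<Longrightarrow> 0 \<le> H i j"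
    and fp: "\<And>i j k l. i \<in> X \<Longrightarrow> j \<in> X \<Longrightarrow> k \<in> X \<Longrightarrow> l \<in> X \<Longrightarrow>
      H i j * H k l \<le> max (H i k * H j l) (H i l * H j k)"
    and r: "r \<in> X" "s \<in> X" "0 < H r s"
    and v: "(\<Sum>j\<in>X. H r j * v j) = 0"
  shows "(\<Sum>i\<in>X. \<Sum>j\<in>X. H i j * v i * v j) \<le> 0"
proof -
  define A where "A = {i \<in> X. 0 < H r i}"
  have AX: "A \<subseteq> X" "finite A" using X by (auto simp: A_def)
  have out: "H r i = 0" if "i \<in> X - A" for i
    using that nn[of r i] r by (force simp: A_def)
  have zero: "H i j = 0" if "i \<in> X - A" "j \<in> X - A" for i j
  proof -
    have "H i j * H r s \<le> 0"
      using fp[of i j r s] that r out[of i] out[of j] sym[of i r] sym[of j r] by auto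
    then show ?thesis using r nn[of i j] that by (auto simp: mult_le_0_iff)
  qed
  have proportional: "H i k * H r l = H i l * H r k" if "i \<in> X - A" "k \<in> X" "l \<in> X" for i k l
  proof -
    have le: "H i k * H r l \<le> H i l * H r k" if "k \<in> X" "l \<in> X" for k l
      using fp[of i k r l] that \<open>i \<in> X - A\<close> r out[of i] sym[of i r] sym[of k r]
        nn[of i l] nn[of r k] by auto
    show ?thesis using le[of k l] le[of l k] that by auto
  qed
  have Hv: "(\<Sum>k\<in>X. H i k * v k) = 0" if "i \<in> X - A" for i
  proof -
    have "H r s * (\<Sum>k\<in>X. H i k * v k) = (\<Sum>k\<in>X. H i k * H r s * v k)"
      by (simp add: sum_distrib_left algebra_simps)
    also have "\<dots> = (\<Sum>k\<in>X. H i s * (H r k * v k))"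
      using proportional[OF that] r by (intro sum.cong) (auto simp: mult.assoc)
    also have "\<dots> = 0" using v by (simp add: sum_distrib_left[symmetric])
    finally show ?thesis using r by simp
  qed
  have HvA: "(\<Sum>k\<in>A. H i k * v k) = 0" if "i \<in> X - A" for i
  proof -
    have "(\<Sum>k\<in>A. H i k * v k) = (\<Sum>k\<in>X. H i k * v k)"
      using X AX zero[OF that] by (intro sum.mono_neutral_left) auto
    then show ?thesis using Hv[OF that] by simp
  qed
  \<comment> \<open>Indices outside \<open>A\<close> are removed first as rows, by
    \<open>Hv\<close>, and then as columns, by symmetry and \<open>HvA\<close>.\<close>
  have "(\<Sum>i\<in>X. \<Sum>j\<in>X. H i j * v i * v j) = (\<Sum>i\<in>X. v i * (\<Sum>j\<in>X. H i j * v j))"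
    by (simp add: sum_distrib_left algebra_simps)
  also have "\<dots> = (\<Sum>i\<in>A. v i * (\<Sum>j\<in>X. H i j * v j))"
    using X AX Hv by (intro sum.mono_neutral_right) auto
  also have "\<dots> = (\<Sum>j\<in>X. \<Sum>i\<in>A. v i * (H i j * v j))"
    unfolding sum_distrib_left by (rule sum.swap)
  also have "\<dots> = (\<Sum>j\<in>X. v j * (\<Sum>i\<in>A. H j i * v i))"
    unfolding sum_distrib_left using AX sym
    by (intro sum.cong refl) (auto simp: algebra_simps)
  also have "\<dots> = (\<Sum>j\<in>A. v j * (\<Sum>i\<in>A. H j i * v i))"
    using X AX HvA by (intro sum.mono_neutral_right) auto
  \<comment> \<open>The rescaled weights \<open>H r i * v i\<close> have sum zero: this is exactly
    the constraint on \<open>v\<close>.\<close>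
  also have "\<dots> = (\<Sum>i\<in>A. \<Sum>j\<in>A. H i j / (H r i * H r j) * (H r i * v i) * (H r j * v j))"
    unfolding sum_distrib_left by (intro sum.cong refl) (auto simp: A_def)
  also have "\<dots> \<le> 0"
  proof (rule ultrametric_sum_nonpos)
    show "finite A" by fact
    show "H i j / (H r i * H r j) = H j i / (H r j * H r i)" if "i \<in> A" "j \<in> A" for i j
      using sym that AX by (simp add: mult.commute subset_iff)
    show "H i j / (H r i * H r j) \<le> max (H i k / (H r i * H r k)) (H j k / (H r j * H r k))"
      if "i \<in> A" "j \<in> A" "k \<in> A" for i j k
    proof -
      have X': "i \<in> X" "j \<in> X" "k \<in> X" and pos: "0 < H r i" "0 < H r j" "0 < H r k"
        using that by (auto simp: A_def)
      have eqs: "H i j / (H r i * H r j) = (H i j * H k r) / (H r i * H r j * H r k)"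
        "H i k / (H r i * H r k) = (H i k * H j r) / (H r i * H r j * H r k)"
        "H j k / (H r j * H r k) = (H i r * H j k) / (H r i * H r j * H r k)"
        using pos X' sym r by (simp_all add: field_simps)
      have "H i j * H k r \<le> max (H i k * H j r) (H i r * H j k)"
        using fp X' r by blast
      then show ?thesis unfolding eqs using pos
        by (auto simp: le_max_iff_disj intro!: divide_right_mono)
    qed
    show "(\<Sum>i\<in>A. H r i * v i) = 0"
      using v X AX out by (subst sum.mono_neutral_left[of X]) auto
  qed
  finally show ?thesis .
qed

section \<open>Spectral gap of nonnegative symmetric matrices\<close>

text \<open>Tychonoff's theorem, for the topology on functions. Vectors indexed by a finite set are
  functions on all of \<open>'a\<close>, which may be infinite.\<close>

lemma compact_PiE_real:
  fixes K :: "'a \<Rightarrow> real set"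
  assumes "\<And>i. compact (K i)"
  shows "compact (Pi\<^sub>E UNIV K)"
proof -
  have "compactin (product_topology (\<lambda>_. euclidean) UNIV) (Pi\<^sub>E UNIV K)"
    using assms by (simp add: compactin_PiE)
  then show ?thesis by (simp add: euclidean_product_topology)
qed

text \<open>Let \<open>D\<close> be the diagonal matrix with \<open>H u = D u\<close>, and let
  \<open>B\<close>, \<open>G\<close> be the forms of \<open>H\<close>, \<open>D\<close>. If
  \<open>B\<close> were positive somewhere on the \<open>G\<close>-orthogonal complement of
  \<open>u\<close>, a maximiser \<open>z\<close> of \<open>B\<close> on the unit sphere there would
  satisfy \<open>H z = \<rho> D z\<close> with \<open>\<rho> > 0\<close>. Then \<open>ineq\<close>
  gives \<open>\<rho> \<ge> 1\<close>, and the Dirichlet form of \<open>H\<close> makes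
  \<open>z\<close> a multiple of \<open>u\<close>, against orthogonality.\<close>

lemma spectral_gap_irreducible:
  fixes H :: "'a \<Rightarrow> 'a \<Rightarrow> real"
  assumes X: "finite X" and sym: "\<And>i j. i \<in> X \<Longrightarrow> j \<in> X \<Longrightarrow> H i j = H j i"
    and nn: "\<And>i j. i \<in> X \<Longrightarrow> j \<in> X \<Longrightarrow> 0 \<le> H i j"
    and u: "\<And>i. i \<in> X \<Longrightarrow> 0 < u i"
    and Hu: "\<And>i. i \<in> X \<Longrightarrow> 0 < (\<Sum>j\<in>X. H i j * u j)"
    and ineq: "\<And>v. (\<Sum>i\<in>X. v i * (\<Sum>j\<in>X. H i j * v j)) \<le>
        (\<Sum>i\<in>X. u i * (\<Sum>j\<in>X. H i j * v j)\<^sup>2 / (\<Sum>j\<in>X. H i j * u j))"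
    and conn: "\<And>i j. i \<in> X \<Longrightarrow> j \<in> X \<Longrightarrow>
        i = j \<or> 0 < H i j \<or> (\<exists>k\<in>X. 0 < H i k \<and> 0 < H k j)"
    and v: "(\<Sum>i\<in>X. v i * (\<Sum>j\<in>X. H i j * u j)) = 0"
  shows "(\<Sum>i\<in>X. v i * (\<Sum>j\<in>X. H i j * v j)) \<le> 0"
proof (rule ccontr)
  define B where "B = (\<lambda>x y. \<Sum>i\<in>X. x i * (\<Sum>j\<in>X. H i j * y j))"
  define D where "D = (\<lambda>i. (\<Sum>j\<in>X. H i j * u j) / u i)"
  define G where "G = (\<lambda>x y. \<Sum>i\<in>X. D i * x i * y i)"
  have D: "0 < D i" if "i \<in> X" for i using u Hu that by (simp add: D_def)
  have Du: "(\<Sum>j\<in>X. H i j * u j) = D i * u i" if "i \<in> X" for i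
    using u[OF that] by (simp add: D_def)
  have Bsym: "B x y = B y x" for x y
  proof -
    have "B x y = (\<Sum>i\<in>X. \<Sum>j\<in>X. x i * (H i j * y j))"
      by (simp add: B_def sum_distrib_left)
    also have "\<dots> = (\<Sum>j\<in>X. \<Sum>i\<in>X. x i * (H i j * y j))" by (rule sum.swap)
    also have "\<dots> = B y x"
      unfolding B_def sum_distrib_left using sym
      by (intro sum.cong refl) (auto simp: algebra_simps)
    finally show ?thesis .
  qed
  have Gsym: "G x y = G y x" for x y by (simp add: G_def algebra_simps)
  have Bu: "B x u = G x u" for x
    unfolding B_def G_def using Du by (intro sum.cong) (auto simp: algebra_simps)
  have Blin: "B (\<lambda>i. a * x i + b * y i) z = a * B x z + b * B y z" for a b x y z
    by (simp add: B_def algebra_simps sum.distrib sum_distrib_left)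
  have Glin: "G (\<lambda>i. a * x i + b * y i) z = a * G x z + b * G y z" for a b x y z
    by (simp add: G_def algebra_simps sum.distrib sum_distrib_left)
  have Bcong: "B x x = B y y" if "\<And>i. i \<in> X \<Longrightarrow> x i = y i" for x y
    unfolding B_def using that by (intro sum.cong arg_cong2[of _ _ _ _ "(*)"]) auto
  have Gpos: "0 < G x x" if "i \<in> X" "x i \<noteq> 0" for x i
  proof -
    have "0 < D i * (x i)\<^sup>2" using D that by simp
    then have "0 < D i * x i * x i" by (simp add: power2_eq_square mult.assoc)
    moreover have "0 \<le> D j * x j * x j" if "j \<in> X" for j
      using D[OF that] by (simp add: mult.assoc)
    ultimately show ?thesis unfolding G_def using X that by (intro sum_pos2) auto
  qed
  have Gnn: "0 \<le> G x x" for x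
    unfolding G_def using D by (intro sum_nonneg) (auto simp: mult.assoc less_imp_le)
  assume "\<not> ?thesis"
  then have Bv: "0 < B v v" by (simp add: B_def)
  then have "\<exists>i\<in>X. v i \<noteq> 0" unfolding B_def by (metis (no_types, lifting) less_irrefl mult_zero_left sum.neutral)
  then have Gv: "0 < G v v" using Gpos by blast
  \<comment> \<open>\<open>G x x = 1\<close> already forces \<open>\<bar>x i\<bar> \<le> c i\<close>
    on \<open>X\<close>. Together with the value 0 outside \<open>X\<close> this places the unit
    sphere of the complement in a compact box.\<close>
  define c where "c = (\<lambda>i. 1 / sqrt (D i))"
  define K where "K = Pi\<^sub>E UNIV (\<lambda>i. if i \<in> X then {- c i..c i} else {0})
      \<inter> {x. G x x = 1 \<and> G x u = 0}"
  have Gcont: "continuous_on UNIV (\<lambda>x. G x x)" "continuous_on UNIV (\<lambda>x. G x u)"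
    and Bcont: "continuous_on UNIV (\<lambda>x. B x x)"
    unfolding G_def B_def by (intro continuous_intros continuous_on_product_coordinates)+
  have "closed {x. G x x = 1 \<and> G x u = 0}"
    using Gcont by (intro closed_Collect_conj closed_Collect_eq) (auto intro: continuous_intros)
  moreover have "compact (Pi\<^sub>E UNIV (\<lambda>i. if i \<in> X then {- c i..c i} else {0}))"
    by (rule compact_PiE_real) auto
  ultimately have "compact K" unfolding K_def by (intro compact_Int_closed)
  have inK: "(\<lambda>i. if i \<in> X then x i / sqrt (G x x) else 0) \<in> K" (is "?y \<in> K")
    if "G x u = 0" "0 < G x x" for x
  proof -
    have Gy: "G ?y ?y = 1"
    proof -
      have "G ?y ?y = (\<Sum>i\<in>X. D i * x i * x i / (sqrt (G x x) * sqrt (G x x)))"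
        unfolding G_def by (intro sum.cong) auto
      also have "\<dots> = G x x / G x x"
        using that by (simp add: sum_divide_distrib[symmetric]) (simp add: G_def)
      finally show ?thesis using that by simp
    qed
    have "G ?y u = G x u / sqrt (G x x)"
      unfolding G_def sum_divide_distrib by (intro sum.cong) auto
    then have "G ?y u = 0" using that by simp
    moreover have "x i / sqrt (G x x) \<in> {- c i..c i}" if "i \<in> X" for i
    proof -
      have "D i * ?y i * ?y i \<le> G ?y ?y"
        unfolding G_def using X that D
        by (intro member_le_sum) (auto simp: mult.assoc less_imp_le)
      then have "(?y i)\<^sup>2 \<le> 1 / D i"
        using D[OF that] Gy by (simp add: field_simps power2_eq_square)
      then have "sqrt ((?y i)\<^sup>2) \<le> sqrt (1 / D i)" by (rule real_sqrt_le_mono)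
      then have "\<bar>?y i\<bar> \<le> c i" by (simp add: c_def real_sqrt_divide)
      then have "?y i \<in> {- c i..c i}" by (metis abs_le_iff atLeastAtMost_iff minus_le_iff)
      then show ?thesis using that by simp
    qed
    then have "?y \<in> Pi\<^sub>E UNIV (\<lambda>i. if i \<in> X then {- c i..c i} else {0})"
      by auto
    ultimately show ?thesis using Gy by (simp add: K_def)
  qed
  have BinK: "B (\<lambda>i. if i \<in> X then x i / sqrt (G x x) else 0)
      (\<lambda>i. if i \<in> X then x i / sqrt (G x x) else 0) = B x x / G x x" for x
  proof -
    have "B (\<lambda>i. if i \<in> X then x i / sqrt (G x x) else 0)
      (\<lambda>i. if i \<in> X then x i / sqrt (G x x) else 0) =
      B (\<lambda>i. (1 / sqrt (G x x)) * x i + 0 * x i) (\<lambda>i. (1 / sqrt (G x x)) * x i + 0 * x i)"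
      by (rule Bcong) simp
    also have "\<dots> = (1 / sqrt (G x x)) * B x (\<lambda>i. (1 / sqrt (G x x)) * x i + 0 * x i)"
      by (subst Blin) simp
    also have "B x (\<lambda>i. (1 / sqrt (G x x)) * x i + 0 * x i) = (1 / sqrt (G x x)) * B x x"
      by (subst Bsym, subst Blin) simp
    finally show ?thesis using Gnn[of x] by simp
  qed
  have vu: "G v u = 0" using v by (simp add: Bu[symmetric] B_def)
  then have "K \<noteq> {}" using inK Gv by blast
  then obtain z where z: "z \<in> K" and zmax: "\<And>y. y \<in> K \<Longrightarrow> B y y \<le> B z z"
    using continuous_attains_sup[OF \<open>compact K\<close>, of "\<lambda>x. B x x"] Bcont
      continuous_on_subset by (metis subset_UNIV)
  define \<rho> where "\<rho> = B z z"
  have z1: "G z z = 1" "G z u = 0" using z by (auto simp: K_def)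
  have psd: "B x x \<le> \<rho> * G x x" if "G x u = 0" for x
  proof (cases "\<exists>i\<in>X. x i \<noteq> 0")
    case True
    then have "0 < G x x" using Gpos by blast
    moreover from this have "B x x / G x x \<le> \<rho>"
      using zmax[OF inK[OF that]] unfolding BinK \<rho>_def by simp
    ultimately show ?thesis by (simp add: field_simps)
  next
    case False
    then have "B x x = 0" "G x x = 0" by (auto simp: B_def G_def intro!: sum.neutral)
    then show ?thesis by simp
  qed
  have "0 < B v v / G v v" using Bv Gv by simp
  also have "\<dots> \<le> \<rho>" using psd[OF vu] Gv by (simp add: field_simps)
  finally have \<rho>: "0 < \<rho>" .
  text \<open>Lagrange multipliers at the maximiser, in the weak form \<open>Hz = \<rho>Dz\<close>.\<close>
  have orth: "B z y = \<rho> * G z y" if yu: "G y u = 0" for y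
  proof -
    have "2 * t * (B z y - \<rho> * G z y) \<le> t\<^sup>2 * (\<rho> * G y y - B y y)" for t
    proof -
      let ?x = "\<lambda>i. 1 * z i + t * y i"
      have "G ?x u = 0" unfolding Glin using z1 yu by simp
      then have "B ?x ?x \<le> \<rho> * G ?x ?x" by (rule psd)
      moreover have "B ?x ?x = \<rho> + 2 * t * B z y + t\<^sup>2 * B y y"
        using Blin[of 1 z t y ?x] Blin[of 1 z t y z] Blin[of 1 z t y y]
          Bsym[of z ?x] Bsym[of y ?x] Bsym[of y z]
        by (simp add: \<rho>_def power2_eq_square algebra_simps)
      moreover have "G ?x ?x = 1 + 2 * t * G z y + t\<^sup>2 * G y y"
        using Glin[of 1 z t y ?x] Glin[of 1 z t y z] Glin[of 1 z t y y]
          Gsym[of z ?x] Gsym[of y ?x] Gsym[of y z] z1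
        by (simp add: power2_eq_square algebra_simps)
      ultimately show ?thesis by (simp add: algebra_simps)
    qed
    note * = this
    define b where "b = B z y - \<rho> * G z y"
    define a where "a = \<rho> * G y y - B y y"
    have a: "0 \<le> a" using psd[OF yu] by (simp add: a_def)
    \<comment> \<open>With this \<open>t\<close> the inequality becomes
      \<open>t\<^sup>2 * (a + 2) \<le> 0\<close>. The summand 1 keeps the denominator positive when
      \<open>a = 0\<close>.\<close>
    define t where "t = b / (a + 1)"
    have bt: "b = t * (a + 1)" using a by (simp add: t_def)
    have "2 * t * b \<le> t\<^sup>2 * a" using *[of t] by (simp add: a_def b_def)
    then have "t\<^sup>2 * (a + 2) \<le> 0" unfolding bt by (simp add: algebra_simps power2_eq_square)
    then have "t = 0" using a by (auto simp: mult_le_0_iff)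
    then have "b = 0" by (simp add: bt)
    then show ?thesis by (simp add: b_def)
  qed
  have Guu: "G u u > 0 \<or> X = {}" using Gpos u by (metis all_not_in_conv less_irrefl)
  have eig0: "B z y = \<rho> * G z y" for y
  proof (cases "X = {}")
    case True then show ?thesis by (simp add: B_def G_def)
  next
    case False
    with Guu have Guu: "G u u > 0" by simp
    \<comment> \<open>Subtracting the \<open>G\<close>-projection onto \<open>u\<close> reduces to
      the orthogonal case. Neither side changes, since \<open>B z u = G z u = 0\<close>.\<close>
    let ?x = "\<lambda>i. 1 * y i + (- (G y u / G u u)) * u i"
    have "G ?x u = 0" unfolding Glin using Guu by simp
    then have "B z ?x = \<rho> * G z ?x" by (rule orth)
    moreover have "B z ?x = B z y"
      unfolding Bsym[of z ?x] Blin using Bsym[of y z] Bsym[of u z] Bu[of z] z1 by simp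
    moreover have "G z ?x = G z y"
      unfolding Gsym[of z ?x] Glin using Gsym[of y z] Gsym[of u z] z1 by simp
    ultimately show ?thesis by simp
  qed
  have eig: "(\<Sum>j\<in>X. H i j * z j) = \<rho> * D i * z i" if "i \<in> X" for i
  proof -
    let ?e = "\<lambda>j. if j = i then 1 else (0::real)"
    have "(\<Sum>j\<in>X. H i j * z j) = B ?e z"
      using X that by (simp add: B_def if_distrib[of "\<lambda>x. x * _"] cong: if_cong)
    moreover have "G z ?e = D i * z i"
      using X that by (simp add: G_def if_distrib[of "\<lambda>x. _ * x"] cong: if_cong)
    ultimately show ?thesis using eig0[of ?e] Bsym[of z ?e] by simp
  qed
  \<comment> \<open>At an eigenvector both sides of \<open>ineq\<close> are explicit, and it reads
    \<open>\<rho> \<le> \<rho>\<^sup>2\<close>.\<close>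
  have "\<rho> \<le> (\<Sum>i\<in>X. u i * (\<Sum>j\<in>X. H i j * z j)\<^sup>2 / (\<Sum>j\<in>X. H i j * u j))"
    using ineq[of z] by (simp add: \<rho>_def B_def)
  also have "\<dots> = (\<Sum>i\<in>X. \<rho>\<^sup>2 * (D i * z i * z i))"
  proof (intro sum.cong refl)
    fix i assume i: "i \<in> X"
    show "u i * (\<Sum>j\<in>X. H i j * z j)\<^sup>2 / (\<Sum>j\<in>X. H i j * u j) = \<rho>\<^sup>2 * (D i * z i * z i)"
      unfolding eig[OF i] Du[OF i] using u[OF i] D[OF i] by (simp add: field_simps power2_eq_square)
  qed
  also have "\<dots> = \<rho>\<^sup>2" using z1(1) by (simp add: sum_distrib_left[symmetric] G_def)
  finally have ge1: "1 \<le> \<rho>" using \<rho> by (simp add: power2_eq_square)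
  define x where "x = (\<lambda>i. z i / u i)"
  have zx: "z i = x i * u i" if "i \<in> X" for i using u[OF that] by (simp add: x_def)
  \<comment> \<open>The Dirichlet form of \<open>x = z / u\<close> equals
    \<open>2 * G z z - 2 * B z z = 2 * (1 - \<rho>)\<close>. It is therefore at most 0, so each of
    its nonnegative terms vanishes.\<close>
  have "(\<Sum>i\<in>X. \<Sum>j\<in>X. H i j * u i * u j * (x i - x j)\<^sup>2)
      = (\<Sum>i\<in>X. \<Sum>j\<in>X. H i j * u i * u j * (x i)\<^sup>2)
        + (\<Sum>i\<in>X. \<Sum>j\<in>X. H i j * u i * u j * (x j)\<^sup>2)
        - 2 * (\<Sum>i\<in>X. \<Sum>j\<in>X. H i j * u i * u j * x i * x j)"
    by (simp add: power2_diff algebra_simps sum.distrib sum_subtractf sum_distrib_left)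
  also have "(\<Sum>i\<in>X. \<Sum>j\<in>X. H i j * u i * u j * (x j)\<^sup>2)
      = (\<Sum>i\<in>X. \<Sum>j\<in>X. H i j * u i * u j * (x i)\<^sup>2)"
    by (subst sum.swap, intro sum.cong refl) (use sym in \<open>auto simp: algebra_simps\<close>)
  also have "(\<Sum>i\<in>X. \<Sum>j\<in>X. H i j * u i * u j * (x i)\<^sup>2)
      = (\<Sum>i\<in>X. u i * (x i)\<^sup>2 * (\<Sum>j\<in>X. H i j * u j))"
    by (simp add: sum_distrib_left algebra_simps)
  also have "\<dots> = G z z"
    unfolding G_def using Du zx by (intro sum.cong refl) (auto simp: power2_eq_square algebra_simps)
  also have "(\<Sum>i\<in>X. \<Sum>j\<in>X. H i j * u i * u j * x i * x j) = B z z"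
    unfolding B_def sum_distrib_left by (intro sum.cong refl) (auto simp: zx algebra_simps)
  finally have "(\<Sum>i\<in>X. \<Sum>j\<in>X. H i j * u i * u j * (x i - x j)\<^sup>2) \<le> 0"
    using z1 ge1 by (simp add: \<rho>_def)
  moreover have nn': "0 \<le> H i j * u i * u j * (x i - x j)\<^sup>2" if "i \<in> X" "j \<in> X" for i j
    using nn that u by (simp add: less_imp_le)
  ultimately have "(\<Sum>i\<in>X. \<Sum>j\<in>X. H i j * u i * u j * (x i - x j)\<^sup>2) = 0"
    by (intro antisym sum_nonneg) auto
  then have vanish: "H i j * u i * u j * (x i - x j)\<^sup>2 = 0" if "i \<in> X" "j \<in> X" for i j
    using that X nn' by (simp add: sum_nonneg_eq_0_iff sum_nonneg)
  then have xeq: "x i = x j" if "i \<in> X" "j \<in> X" "0 < H i j" for i j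
    using that u[of i] u[of j] vanish[of i j] by auto
  \<comment> \<open>\<open>x\<close> agrees across every positive entry of \<open>H\<close>, and any
    two indices are joined by at most two such entries.\<close>
  have const: "x i = x j" if "i \<in> X" "j \<in> X" for i j
    using conn[OF that] xeq that by metis
  have "X \<noteq> {}" using z1(1) by (auto simp: G_def)
  then obtain r where r: "r \<in> X" by blast
  have "G z u = x r * G u u"
    unfolding G_def sum_distrib_left using const[OF _ r] zx by (intro sum.cong) (auto simp: algebra_simps)
  then have "x r = 0" using z1(2) Guu r by auto
  then have "z i = 0" if "i \<in> X" for i using const[OF that r] zx[OF that] by simp
  then have "G z z = 0" by (auto simp: G_def intro!: sum.neutral)
  then show False using z1 by simp
qed

text \<open>Since \<open>H\<close> is nonnegative and \<open>u\<close> positive, an index at which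
  \<open>H u\<close> is zero has a zero row and column. Restricting to the remaining set
  \<open>L\<close> gives the irreducible case. The terms of \<open>ineq\<close> outside
  \<open>L\<close> have numerator 0, and an intermediate index supplied by \<open>conn\<close> lies
  in \<open>L\<close> automatically.\<close>

lemma spectral_gap:
  fixes H :: "'a \<Rightarrow> 'a \<Rightarrow> real"
  assumes X: "finite X" and sym: "\<And>i j. i \<in> X \<Longrightarrow> j \<in> X \<Longrightarrow> H i j = H j i"
    and nn: "\<And>i j. i \<in> X \<Longrightarrow> j \<in> X \<Longrightarrow> 0 \<le> H i j"
    and u: "\<And>i. i \<in> X \<Longrightarrow> 0 < u i"
    and ineq: "\<And>v. (\<Sum>i\<in>X. v i * (\<Sum>j\<in>X. H i j * v j)) \<le>
        (\<Sum>i\<in>X. u i * (\<Sum>j\<in>X. H i j * v j)\<^sup>2 / (\<Sum>j\<in>X. H i j * u j))"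
    and conn: "\<And>i j. i \<in> X \<Longrightarrow> j \<in> X \<Longrightarrow>
        0 < (\<Sum>k\<in>X. H i k * u k) \<Longrightarrow> 0 < (\<Sum>k\<in>X. H j k * u k) \<Longrightarrow>
        i = j \<or> 0 < H i j \<or> (\<exists>k\<in>X. 0 < H i k \<and> 0 < H k j)"
    and v: "(\<Sum>i\<in>X. v i * (\<Sum>j\<in>X. H i j * u j)) = 0"
  shows "(\<Sum>i\<in>X. v i * (\<Sum>j\<in>X. H i j * v j)) \<le> 0"
proof -
  define L where "L = {i \<in> X. 0 < (\<Sum>j\<in>X. H i j * u j)}"
  have L: "L \<subseteq> X" "finite L" using X by (auto simp: L_def)
  have pos: "i \<in> L" if "i \<in> X" "j \<in> X" "0 < H i j" for i j
    unfolding L_def using that X nn u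
    by (auto intro!: sum_pos2[of X j] mult_nonneg_nonneg simp: less_imp_le)
  have zero: "H i j = 0" if "i \<in> X" "j \<in> X" "i \<notin> L \<or> j \<notin> L" for i j
    using pos[of i j] pos[of j i] that nn[of i j] sym[of i j] by fastforce
  have in_sum: "(\<Sum>j\<in>X. H i j * y j) = (\<Sum>j\<in>L. H i j * y j)" if "i \<in> X" for i y
    using X L zero that by (intro sum.mono_neutral_right) auto
  have out0: "(\<Sum>j\<in>X. H i j * y j) = 0" if "i \<in> X - L" for i y
    using zero that by (intro sum.neutral) auto
  have form: "(\<Sum>i\<in>X. x i * (\<Sum>j\<in>X. H i j * y j)) = (\<Sum>i\<in>L. x i * (\<Sum>j\<in>L. H i j * y j))" for x y
  proof -
    have "(\<Sum>i\<in>X. x i * (\<Sum>j\<in>X. H i j * y j)) = (\<Sum>i\<in>L. x i * (\<Sum>j\<in>X. H i j * y j))"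
      using X L out0 by (intro sum.mono_neutral_right) auto
    also have "\<dots> = (\<Sum>i\<in>L. x i * (\<Sum>j\<in>L. H i j * y j))"
      using L in_sum by (intro sum.cong) auto
    finally show ?thesis .
  qed
  have rhs: "(\<Sum>i\<in>X. u i * (\<Sum>j\<in>X. H i j * y j)\<^sup>2 / (\<Sum>j\<in>X. H i j * u j))
      = (\<Sum>i\<in>L. u i * (\<Sum>j\<in>L. H i j * y j)\<^sup>2 / (\<Sum>j\<in>L. H i j * u j))" for y
  proof -
    have "(\<Sum>i\<in>X. u i * (\<Sum>j\<in>X. H i j * y j)\<^sup>2 / (\<Sum>j\<in>X. H i j * u j))
      = (\<Sum>i\<in>L. u i * (\<Sum>j\<in>X. H i j * y j)\<^sup>2 / (\<Sum>j\<in>X. H i j * u j))"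
      using X L out0 by (intro sum.mono_neutral_right) auto
    also have "\<dots> = (\<Sum>i\<in>L. u i * (\<Sum>j\<in>L. H i j * y j)\<^sup>2 / (\<Sum>j\<in>L. H i j * u j))"
      using L in_sum by (intro sum.cong) auto
    finally show ?thesis .
  qed
  show ?thesis unfolding form
  proof (rule spectral_gap_irreducible[where u = u])
    show "0 < u i" "0 < (\<Sum>j\<in>L. H i j * u j)" if "i \<in> L" for i
      using that in_sum[of i u] u[of i] by (auto simp: L_def)
    show "(\<Sum>i\<in>L. y i * (\<Sum>j\<in>L. H i j * y j))
        \<le> (\<Sum>i\<in>L. u i * (\<Sum>j\<in>L. H i j * y j)\<^sup>2 / (\<Sum>j\<in>L. H i j * u j))" for y
      using ineq[of y] unfolding form rhs .
    show "i = j \<or> 0 < H i j \<or> (\<exists>k\<in>L. 0 < H i k \<and> 0 < H k j)" if "i \<in> L" "j \<in> L" for i j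
      using that conn[of i j] pos unfolding L_def by blast
    show "(\<Sum>i\<in>L. v i * (\<Sum>j\<in>L. H i j * u j)) = 0" using v unfolding form .
    show "finite L" by fact
    show "H i j = H j i" "0 \<le> H i j" if "i \<in> L" "j \<in> L" for i j
      using sym[of i j] nn[of i j] that L by blast+
  qed
qed

section \<open>Exchange weights and contraction\<close>

text \<open>Multiplicative form of the axiom of a valuated matroid. Weights live on all sets and
  vanish off the \<open>r\<close>-subsets of \<open>X\<close>. The zero function is allowed, so that
  contracting a loop stays in the class.\<close>

definition exchange_weights :: "'a set \<Rightarrow> nat \<Rightarrow> ('a set \<Rightarrow> real) \<Rightarrow> bool" where
  "exchange_weights X r p \<longleftrightarrow>
     (\<forall>S. 0 \<le> p S) \<and> (\<forall>S. 0 < p S \<longrightarrow> S \<subseteq> X \<and> card S = r) \<and>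
     (\<forall>S T. \<forall>s \<in> S - T. 0 < p S \<longrightarrow> 0 < p T \<longrightarrow>
        (\<exists>t \<in> T - S. p S * p T \<le> p (insert t (S - {s})) * p (insert s (T - {t}))))"

lemma exchange_weights_nonneg: "exchange_weights X r p \<Longrightarrow> 0 \<le> p S"
  by (simp add: exchange_weights_def)

lemma exchange_weights_support: "exchange_weights X r p \<Longrightarrow> 0 < p S \<Longrightarrow> S \<subseteq> X \<and> card S = r"
  by (simp add: exchange_weights_def)

lemma exchange_weights_exchange:
  assumes "exchange_weights X r p" "s \<in> S - T" "0 < p S" "0 < p T"
  shows "\<exists>t \<in> T - S. p S * p T \<le> p (insert t (S - {s})) * p (insert s (T - {t}))"
  using assms unfolding exchange_weights_def by meson

text \<open>The partial derivative by \<open>x i\<close> of the multiaffine polynomial with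
  coefficients \<open>p\<close>. The value 0 on sets containing \<open>i\<close> makes the second
  derivative by the same variable vanish.\<close>

definition contract :: "'a \<Rightarrow> ('a set \<Rightarrow> real) \<Rightarrow> 'a set \<Rightarrow> real" where
  "contract i p S = (if i \<in> S then 0 else p (insert i S))"

lemma contract_commute: "contract i (contract j p) = contract j (contract i p)"
  by (auto simp: contract_def fun_eq_iff insert_commute)

text \<open>An exchange between \<open>insert i S\<close> and \<open>insert i T\<close> never moves
  \<open>i\<close>, which lies in both.\<close>

lemma exchange_weights_contract:
  assumes X: "finite X" and p: "exchange_weights X (Suc r) p"
  shows "exchange_weights X r (contract i p)"
  unfolding exchange_weights_def
proof (intro conjI allI ballI impI)
  show "0 \<le> contract i p S" for S
    using p by (simp add: contract_def exchange_weights_nonneg)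
  fix S assume S: "0 < contract i p S"
  then have iS: "i \<notin> S" "0 < p (insert i S)" by (auto simp: contract_def split: if_splits)
  then have "insert i S \<subseteq> X" "card (insert i S) = Suc r"
    using exchange_weights_support[OF p] by auto
  then show "S \<subseteq> X" "card S = r"
    using iS finite_subset[OF _ X, of S] by auto
  fix T s assume s: "s \<in> S - T" and T: "0 < contract i p T"
  then have iT: "i \<notin> T" "0 < p (insert i T)" by (auto simp: contract_def split: if_splits)
  have "s \<noteq> i" using s iS by auto
  then obtain t where t: "t \<in> insert i T - insert i S" and
    le: "p (insert i S) * p (insert i T)
      \<le> p (insert t (insert i S - {s})) * p (insert s (insert i T - {t}))"
    using exchange_weights_exchange[OF p _ iS(2) iT(2), of s] s by blast
  have "t \<noteq> i" using t by blast
  have eq: "insert i (insert t (S - {s})) = insert t (insert i S - {s})"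
    "insert i (insert s (T - {t})) = insert s (insert i T - {t})"
    using t \<open>s \<noteq> i\<close> by auto
  have c: "contract i p (insert t (S - {s})) = p (insert t (insert i S - {s}))"
    "contract i p (insert s (T - {t})) = p (insert s (insert i T - {t}))"
    "contract i p S = p (insert i S)" "contract i p T = p (insert i T)"
    unfolding contract_def eq using \<open>t \<noteq> i\<close> iS iT \<open>s \<noteq> i\<close> by auto
  have "contract i p S * contract i p T
      \<le> contract i p (insert t (S - {s})) * contract i p (insert s (T - {t}))"
    unfolding c by (rule le)
  moreover have "t \<in> T - S" using t by blast
  ultimately show "\<exists>t\<in>T - S. contract i p S * contract i p T
      \<le> contract i p (insert t (S - {s})) * contract i p (insert s (T - {t}))"
    by blast
qed

section \<open>Polarisation of the basis polynomial\<close>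

text \<open>The polarisation of the multiaffine polynomial \<open>\<Sum>S. p S * (\<Prod>i\<in>S. x i)\<close>.\<close>

fun polar :: "'a set \<Rightarrow> ('a \<Rightarrow> real) list \<Rightarrow> ('a set \<Rightarrow> real) \<Rightarrow> real" where
  "polar X [] p = p {}"
| "polar X (u # us) p = (\<Sum>i\<in>X. u i * polar X us (contract i p))"

lemma polar_swap: "polar X (u # v # us) p = polar X (v # u # us) p"
proof -
  have "polar X (u # v # us) p
      = (\<Sum>i\<in>X. \<Sum>j\<in>X. u i * (v j * polar X us (contract j (contract i p))))"
    by (simp add: sum_distrib_left)
  also have "\<dots> = (\<Sum>j\<in>X. \<Sum>i\<in>X. u i * (v j * polar X us (contract j (contract i p))))"
    by (rule sum.swap)
  also have "\<dots> = polar X (v # u # us) p"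
    by (simp add: sum_distrib_left contract_commute[of _ _ p] mult.left_commute)
  finally show ?thesis .
qed

lemma polar_move: "polar X (us @ u # vs) p = polar X (u # us @ vs) p"
proof (induction us arbitrary: p)
  case (Cons w us)
  have "polar X (w # us @ u # vs) p = polar X (w # u # us @ vs) p"
    using Cons.IH by simp
  then show ?case using polar_swap by (metis append_Cons)
qed simp

lemma polar_zero: "(\<And>S. p S = 0) \<Longrightarrow> polar X us p = 0"
  by (induction us arbitrary: p) (auto simp: contract_def intro!: sum.neutral)

lemma polar_nonneg:
  assumes "\<And>S. 0 \<le> p S" "\<And>u i. u \<in> set us \<Longrightarrow> i \<in> X \<Longrightarrow> 0 \<le> u i"
  shows "0 \<le> polar X us p"
  using assms
proof (induction us arbitrary: p)
  case (Cons u us)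
  have "0 \<le> polar X us (contract i p)" for i
    using Cons.prems by (intro Cons.IH) (auto simp: contract_def)
  then show ?case using Cons.prems(2) by (auto intro!: sum_nonneg mult_nonneg_nonneg)
qed simp

text \<open>Taking the elements of \<open>S\<close> off one at a time keeps a positive coefficient,
  and all other terms are nonnegative.\<close>

lemma polar_pos:
  assumes "finite X" "exchange_weights X (length us) p" "0 < p S"
    and "\<And>u i. u \<in> set us \<Longrightarrow> i \<in> X \<Longrightarrow> 0 < u i"
  shows "0 < polar X us p"
  using assms(2-4)
proof (induction us arbitrary: p S)
  case Nil
  then have "finite S" "card S = 0"
    using exchange_weights_support[OF Nil(1,2)] assms(1) finite_subset by auto
  then show ?case using Nil by simp
next
  case (Cons u us)
  have S: "S \<subseteq> X" "card S = Suc (length us)"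
    using exchange_weights_support[OF Cons.prems(1,2)] by auto
  then obtain i where i: "i \<in> S" by fastforce
  have ex: "exchange_weights X (length us) (contract j p)" for j
    using Cons.prems assms(1) exchange_weights_contract by auto
  have "0 < contract i p (S - {i})"
    using i Cons.prems(2) by (simp add: contract_def insert_absorb)
  then have "0 < polar X us (contract i p)" using Cons.IH[OF ex] Cons.prems by simp
  then have "0 < u i * polar X us (contract i p)" using Cons.prems i S by auto
  moreover have "0 \<le> u j * polar X us (contract j p)" if "j \<in> X" for j
    using Cons.prems(3) that exchange_weights_nonneg[OF ex]
    by (auto intro!: mult_nonneg_nonneg polar_nonneg simp: less_imp_le)
  ultimately show ?case using assms(1) i S by (auto intro!: sum_pos2[of X i])
qed

section \<open>The Alexandrov-Fenchel inequality\<close>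

text \<open>Exchanging \<open>i\<close> out of \<open>{i, j}\<close> against \<open>k\<close> or
  \<open>l\<close> yields the two products on the right. If an index of the first pair equals one of
  the second, one of these products equals the left side; if a pair is degenerate, the left side is
  0.\<close>

lemma exchange_weights_four_point:
  assumes X: "finite X" and p: "exchange_weights X 2 p"
  defines "H \<equiv> \<lambda>i j. contract j (contract i p) {}"
  shows "H i j * H k l \<le> max (H i k * H j l) (H i l * H j k)"
proof -
  have H: "H i j = (if i = j then 0 else p {i, j})" for i j
    by (auto simp: H_def contract_def insert_commute)
  have nn: "0 \<le> H i j" for i j using p by (simp add: H exchange_weights_nonneg)
  have sym: "H i j = H j i" for i j by (simp add: H insert_commute)
  show ?thesis
  proof (cases "0 < H i j * H k l \<and> i \<noteq> k \<and> i \<noteq> l \<and> j \<noteq> k \<and> j \<noteq> l")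
    case True
    then have pos: "0 < H i j" "0 < H k l" using nn[of i j] nn[of k l]
      by (auto simp: zero_less_mult_iff)
    then have ne: "i \<noteq> j" "k \<noteq> l" by (auto simp: H)
    have "\<exists>t\<in>{k, l} - {i, j}. p {i, j} * p {k, l}
        \<le> p (insert t ({i, j} - {i})) * p (insert i ({k, l} - {t}))"
      using True pos ne by (intro exchange_weights_exchange[OF p]) (auto simp: H)
    moreover have "{i, j} - {i} = {j}" "{k, l} - {k} = {l}" "{k, l} - {l} = {k}" using ne by auto
    ultimately have "p {i, j} * p {k, l} \<le> p {k, j} * p {i, l} \<or>
        p {i, j} * p {k, l} \<le> p {l, j} * p {i, k}"
      using ne True by auto
    then have "H i j * H k l \<le> H i l * H j k \<or> H i j * H k l \<le> H i k * H j l"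
      using ne True by (auto simp: H insert_commute mult.commute)
    then show ?thesis by auto
  next
    case False
    then consider "H i j * H k l \<le> 0" | "i = k" | "i = l" | "j = k" | "j = l" by linarith
    then have "H i j * H k l \<le> H i k * H j l \<or> H i j * H k l \<le> H i l * H j k"
    proof cases
      case 1
      moreover have "0 \<le> H i k * H j l" using nn by simp
      ultimately show ?thesis by linarith
    qed (use sym[of j k] sym[of j l] sym[of i j] sym[of k l] in auto)
    then show ?thesis by (simp only: le_max_iff_disj)
  qed
qed

lemma polar_linear_left:
  "polar X ((\<lambda>i. a * x i + b * y i) # us) p = a * polar X (x # us) p + b * polar X (y # us) p"
  by (simp add: algebra_simps sum.distrib sum_distrib_left)

lemma polar_two:
  "polar X (x # y # us) p = (\<Sum>i\<in>X. x i * (\<Sum>j\<in>X. polar X us (contract j (contract i p)) * y j))"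
  by (simp add: mult.commute)

text \<open>By \<open>reverse_cauchy_schwarz\<close> it suffices to find \<open>e\<close> such that
  the form is nonpositive on the hyperplane orthogonal to \<open>e\<close>. In rank two
  \<open>e\<close> is the coordinate vector of a nonzero row, via \<open>four_point_nonpos\<close>;
  in higher rank it is the first fixed vector \<open>u\<close>, via
  \<open>spectral_gap\<close>.\<close>

theorem polar_alexandrov_fenchel_pos:
  assumes X: "finite X" and "exchange_weights X (length us + 2) p"
    and "\<And>u i. u \<in> set us \<Longrightarrow> i \<in> X \<Longrightarrow> 0 < u i"
    and "\<And>i. i \<in> X \<Longrightarrow> 0 \<le> w i"
  shows "polar X (v # v # us) p * polar X (w # w # us) p \<le> (polar X (v # w # us) p)\<^sup>2"
  using assms(2-4)
proof (induction us arbitrary: p v w)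
  case Nil
  have p: "exchange_weights X 2 p" using Nil.prems(1) by (simp add: numeral_2_eq_2)
  define H where "H = (\<lambda>i j. contract j (contract i p) {})"
  have B: "polar X [x, y] p = (\<Sum>i\<in>X. x i * (\<Sum>j\<in>X. H i j * y j))" for x y
    unfolding polar_two by (simp add: H_def)
  have "\<exists>e. \<forall>x. polar X [x, e] p = 0 \<longrightarrow> polar X [x, x] p \<le> 0"
  proof (cases "\<exists>r\<in>X. \<exists>s\<in>X. 0 < H r s")
    case True
    then obtain r s where r: "r \<in> X" "s \<in> X" "0 < H r s" by blast
    define e where "e = (\<lambda>i. if i = r then 1 else (0::real))"
    have "polar X [x, x] p \<le> 0" if "polar X [x, e] p = 0" for x
    proof -
      have "polar X [e, x] p = 0" using that polar_swap by metis
      then have orth: "(\<Sum>j\<in>X. H r j * x j) = 0"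
        unfolding B e_def using X r by (simp add: if_distrib[of "\<lambda>x. x * _"] cong: if_cong)
      have "(\<Sum>i\<in>X. \<Sum>j\<in>X. H i j * x i * x j) \<le> 0"
      proof (rule four_point_nonpos[where r = r and s = s])
        show "H i j = H j i" "0 \<le> H i j" for i j
          using exchange_weights_nonneg[OF p] by (auto simp: H_def contract_def insert_commute)
        show "H i j * H k l \<le> max (H i k * H j l) (H i l * H j k)" for i j k l
          unfolding H_def by (rule exchange_weights_four_point[OF X p])
      qed (fact X r orth)+
      then show ?thesis unfolding B by (simp add: sum_distrib_left algebra_simps)
    qed
    then show ?thesis by blast
  next
    case False
    have "0 \<le> H i j" for i j
      using exchange_weights_nonneg[OF p] by (auto simp: H_def contract_def)
    then have "H i j = 0" if "i \<in> X" "j \<in> X" for i j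
      using False that by (metis antisym_conv2)
    then have "polar X [x, x] p = 0" for x unfolding B by simp
    then show ?thesis by simp
  qed
  then obtain e where e: "\<And>x. polar X [x, e] p = 0 \<Longrightarrow> polar X [x, x] p \<le> 0" by blast
  show ?case
  proof (rule reverse_cauchy_schwarz[where B = "\<lambda>x y. polar X [x, y] p"])
    show "polar X [w, w] p \<ge> 0"
      using Nil.prems exchange_weights_nonneg[OF p] by (intro polar_nonneg) auto
  qed (fact polar_swap polar_linear_left e)+
next
  case (Cons u us)
  note p = Cons.prems(1) and u = Cons.prems(2)
  define H where "H = (\<lambda>i j. polar X (u # us) (contract j (contract i p)))"
  have B: "polar X (x # y # u # us) p = (\<Sum>i\<in>X. x i * (\<Sum>j\<in>X. H i j * y j))" for x y
    unfolding polar_two H_def by simp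
  have Hx: "(\<Sum>j\<in>X. H i j * x j) = polar X (x # u # us) (contract i p)" for i x
    by (simp add: H_def mult.commute)
  have p1: "exchange_weights X (length us + 2) (contract i p)" for i
    using p X by (intro exchange_weights_contract) auto
  have p2: "exchange_weights X (length (u # us)) (contract j (contract i p))" for i j
    using exchange_weights_contract[OF X, of "Suc (length us)" "contract i p" j] p1[of i] by simp
  have upos: "0 < u i" if "i \<in> X" for i using u that by simp
  have Hpos: "0 < H i j" if "i \<in> S" "j \<in> S" "i \<noteq> j" "0 < p S" for i j S
  proof -
    have "0 < contract j (contract i p) (S - {i} - {j})"
      using that by (simp add: contract_def insert_absorb insert_Diff)
    then show ?thesis unfolding H_def using u by (intro polar_pos[OF X p2]) auto
  qed
  have neg: "polar X (x # x # u # us) p \<le> 0" if "polar X (x # u # u # us) p = 0" for x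
    unfolding B
  proof (rule spectral_gap[where u = u])
    show "finite X" by fact
    show "H i j = H j i" for i j by (simp only: H_def contract_commute)
    show "0 \<le> H i j" for i j
      unfolding H_def using u exchange_weights_nonneg[OF p2]
      by (intro polar_nonneg) (auto simp: less_imp_le)
    show "0 < u i" if "i \<in> X" for i using upos that .
    show "(\<Sum>i\<in>X. x i * (\<Sum>j\<in>X. H i j * u j)) = 0" using that unfolding B .
    show "(\<Sum>i\<in>X. y i * (\<Sum>j\<in>X. H i j * y j)) \<le>
        (\<Sum>i\<in>X. u i * (\<Sum>j\<in>X. H i j * y j)\<^sup>2 / (\<Sum>j\<in>X. H i j * u j))" for y
    proof -
      \<comment> \<open>Moving \<open>u\<close> to the front writes the form as a combination, with
        weights \<open>u i\<close>, of the forms of the contractions, to which the induction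
        hypothesis applies.\<close>
      have "(\<Sum>i\<in>X. y i * (\<Sum>j\<in>X. H i j * y j)) = polar X (u # y # y # us) p"
        unfolding B[symmetric] using polar_move[of X "[y, y]" u us p] unfolding append.simps .
      also have "\<dots> = (\<Sum>i\<in>X. u i * polar X (y # y # us) (contract i p))"
        by (rule polar.simps)
      also have "\<dots> \<le> (\<Sum>i\<in>X. u i * (\<Sum>j\<in>X. H i j * y j)\<^sup>2 / (\<Sum>j\<in>X. H i j * u j))"
      proof (rule sum_mono)
        fix i assume i: "i \<in> X"
        let ?P = "\<lambda>z z'. polar X (z # z' # us) (contract i p)"
        \<comment> \<open>The induction hypothesis is compared with \<open>u\<close> itself, so that
          dividing by \<open>?P u u\<close> gives the summand wanted. If \<open>i\<close> is a loop,
          the contraction is zero and so are both sides.\<close>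
        have le: "?P y y * ?P u u \<le> (?P y u)\<^sup>2"
          using Cons.IH[OF p1] u by (simp add: less_imp_le)
        show "u i * ?P y y \<le> u i * (\<Sum>j\<in>X. H i j * y j)\<^sup>2 / (\<Sum>j\<in>X. H i j * u j)"
        proof (cases "\<exists>S. 0 < contract i p S")
          case True
          then have "0 < ?P u u"
            using p1 u by (auto intro!: polar_pos[OF X, of "u # u # us"] simp del: polar.simps)
          then have "?P y y \<le> (?P y u)\<^sup>2 / ?P u u" using le by (simp add: field_simps)
          then have "u i * ?P y y \<le> u i * ((?P y u)\<^sup>2 / ?P u u)"
            using upos[OF i] by (intro mult_left_mono) auto
          then show ?thesis unfolding Hx by (simp del: polar.simps)
        next
          case False
          then have "contract i p S = 0" for S
            using exchange_weights_nonneg[OF p1] by (metis antisym_conv2)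
          then have "polar X zs (contract i p) = 0" for zs by (intro polar_zero)
          then show ?thesis unfolding Hx by (simp del: polar.simps)
        qed
      qed
      finally show ?thesis .
    qed
    show "i = j \<or> 0 < H i j \<or> (\<exists>k\<in>X. 0 < H i k \<and> 0 < H k j)"
      if "i \<in> X" "j \<in> X" and pos: "0 < (\<Sum>k\<in>X. H i k * u k)" "0 < (\<Sum>k\<in>X. H j k * u k)" for i j
    proof -
      \<comment> \<open>A positive entry of \<open>H u\<close> at \<open>i\<close> means that some
        set of positive weight contains \<open>i\<close>.\<close>
      have nonloop: "\<exists>S. i \<in> S \<and> 0 < p S" if "0 < (\<Sum>k\<in>X. H i k * u k)" for i
      proof -
        have "\<exists>S. contract i p S \<noteq> 0"
          using that polar_zero[of "contract i p"] unfolding Hx by (metis less_irrefl)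
        then obtain S where "p (insert i S) \<noteq> 0" by (auto simp: contract_def split: if_splits)
        then show ?thesis using exchange_weights_nonneg[OF p]
          by (metis antisym_conv2 insertI1)
      qed
      obtain S T where S: "i \<in> S" "0 < p S" and T: "j \<in> T" "0 < p T"
        using nonloop[OF pos(1)] nonloop[OF pos(2)] by auto
      show ?thesis
      proof (cases "i = j \<or> j \<in> S \<or> i \<in> T")
        case True
        then show ?thesis using Hpos[of i S j] Hpos[of i T j] S T by auto
      next
        case False
        then obtain t where t: "t \<in> T - S"
          and le: "p S * p T \<le> p (insert t (S - {i})) * p (insert i (T - {t}))"
          using exchange_weights_exchange[OF p _ S(2) T(2), of i] S(1) by blast
        have "0 < p (insert t (S - {i})) * p (insert i (T - {t}))"
          using S T le by (meson less_le_trans mult_pos_pos)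
        then have ex: "0 < p (insert t (S - {i}))" "0 < p (insert i (T - {t}))"
          using exchange_weights_nonneg[OF p] by (metis less_le mult_eq_0_iff)+
        \<comment> \<open>If \<open>t\<close> is not \<open>j\<close>, the second new set contains
          both \<open>i\<close> and \<open>j\<close>. If \<open>t = j\<close>, any further element
          \<open>k\<close> of \<open>S\<close> is joined to \<open>i\<close> through
          \<open>S\<close> and to \<open>j\<close> through
          \<open>insert j (S - {i})\<close>.\<close>
        show ?thesis
        proof (cases "t = j")
          case True
          have "card S = length us + 3" "S \<subseteq> X" using exchange_weights_support[OF p S(2)] by auto
          then have "\<not> S \<subseteq> {i}" using card_mono[of "{i}" S] by auto
          then obtain k where "k \<in> S" "k \<noteq> i" by blast
          then have "0 < H i k" "0 < H k j"
            using Hpos[of i S k] Hpos[of k "insert t (S - {i})" j] S ex True False by auto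
          then show ?thesis using \<open>k \<in> S\<close> \<open>S \<subseteq> X\<close> by blast
        next
          case ne: False
          then show ?thesis using Hpos[of i "insert i (T - {t})" j] T ex False by auto
        qed
      qed
    qed
  qed
  show ?case
  proof (rule reverse_cauchy_schwarz[where B = "\<lambda>x y. polar X (x # y # u # us) p"])
    show "polar X (w # w # u # us) p \<ge> 0"
      using Cons.prems(3) u exchange_weights_nonneg[OF p]
      by (intro polar_nonneg) (auto simp: less_imp_le)
  qed (fact polar_swap polar_linear_left neg)+
qed

lemma tendsto_polar:
  "((\<lambda>\<epsilon>. polar X (map (\<lambda>u i. u i + \<epsilon>) us) p) \<longlongrightarrow> polar X us p) (at_right 0)"
proof (induction us arbitrary: p)
  case (Cons u us)
  have "((\<lambda>\<epsilon>. u i + \<epsilon>) \<longlongrightarrow> u i) (at_right 0)" for i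
    by (rule tendsto_eq_intros refl)+ simp
  with Cons show ?case by (auto intro!: tendsto_sum tendsto_mult)
qed simp

text \<open>Indicator vectors have zero entries, so the fixed vectors are first shifted by
  \<open>\<epsilon> > 0\<close>; the inequality survives the limit.\<close>

theorem polar_alexandrov_fenchel:
  assumes X: "finite X" and p: "exchange_weights X (length us + 2) p"
    and us: "\<And>u i. u \<in> set us \<Longrightarrow> i \<in> X \<Longrightarrow> 0 \<le> u i"
    and w: "\<And>i. i \<in> X \<Longrightarrow> 0 \<le> w i"
  shows "polar X (v # v # us) p * polar X (w # w # us) p \<le> (polar X (v # w # us) p)\<^sup>2"
proof -
  define us' where "us' = (\<lambda>\<epsilon>. map (\<lambda>u i. u i + \<epsilon>) us)"
  have lim: "((\<lambda>\<epsilon>. polar X (x # y # us' \<epsilon>) p) \<longlongrightarrow> polar X (x # y # us) p) (at_right 0)" for x y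
    unfolding polar.simps us'_def
    by (intro tendsto_sum tendsto_mult tendsto_const tendsto_polar)
  have "\<forall>\<^sub>F \<epsilon> in at_right 0. polar X (v # v # us' \<epsilon>) p * polar X (w # w # us' \<epsilon>) p
      \<le> (polar X (v # w # us' \<epsilon>) p)\<^sup>2"
    using eventually_at_right_less
  proof eventually_elim
    case (elim \<epsilon>)
    then show ?case
      using p us w by (intro polar_alexandrov_fenchel_pos[OF X])
        (auto simp: us'_def simp del: polar.simps intro!: add_nonneg_pos)
  qed
  then show ?thesis
    by (intro tendsto_le[OF trivial_limit_at_right_real
          tendsto_power[OF lim] tendsto_mult[OF lim lim]])
qed

section \<open>Evaluation at indicator vectors\<close>

text \<open>For disjoint finite \<open>E\<close> and \<open>F\<close>, the coefficient of
  \<open>x^a y^b\<close> after substituting \<open>x\<close> for the variables in \<open>E\<close>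
  and \<open>y\<close> for those in \<open>F\<close>.\<close>

definition slice :: "'a set \<Rightarrow> 'a set \<Rightarrow> nat \<Rightarrow> nat \<Rightarrow> ('a set \<Rightarrow> real) \<Rightarrow> real" where
  "slice E F a b p = sum p {S. S \<subseteq> E \<union> F \<and> card (S \<inter> E) = a \<and> card (S \<inter> F) = b}"

lemma slice_commute: "slice E F a b p = slice F E b a p"
  unfolding slice_def by (rule sum.cong) auto

text \<open>Double counting of pairs \<open>(i, T)\<close> with \<open>i\<close> in both
  \<open>T\<close> and \<open>E\<close>: each \<open>T\<close> occurs \<open>Suc a\<close>
  times.\<close>

lemma sum_slice_contract:
  assumes fin: "finite E" "finite F" and disj: "E \<inter> F = {}"
  shows "(\<Sum>i\<in>E. slice E F a b (contract i p)) = real (Suc a) * slice E F (Suc a) b p"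
proof -
  define A where "A = (\<lambda>a. {S. S \<subseteq> E \<union> F \<and> card (S \<inter> E) = a \<and> card (S \<inter> F) = b})"
  have slice: "slice E F a b f = sum f (A a)" for a f by (simp add: slice_def A_def)
  have finA: "finite (A a)" for a
    unfolding A_def by (rule finite_subset[of _ "Pow (E \<union> F)"]) (use fin in auto)
  have "(\<Sum>i\<in>E. slice E F a b (contract i p)) = (\<Sum>i\<in>E. \<Sum>T | T \<in> A (Suc a) \<and> i \<in> T. p T)"
  proof (intro sum.cong refl)
    fix i assume i: "i \<in> E"
    then have iF: "i \<notin> F" using disj by auto
    have "slice E F a b (contract i p) = (\<Sum>S | S \<in> A a \<and> i \<notin> S. p (insert i S))"
      unfolding slice using finA
      by (intro sum.mono_neutral_cong_right) (auto simp: contract_def)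
    also have "\<dots> = (\<Sum>T | T \<in> A (Suc a) \<and> i \<in> T. p T)"
    proof (rule sum.reindex_bij_witness[of _ "\<lambda>T. T - {i}" "insert i"])
      fix S assume S: "S \<in> {S \<in> A a. i \<notin> S}"
      then have "finite (S \<inter> E)" using fin by auto
      moreover have "insert i S \<inter> E = insert i (S \<inter> E)" "insert i S \<inter> F = S \<inter> F"
        using i iF by auto
      ultimately show "insert i S \<in> {T \<in> A (Suc a). i \<in> T}"
        using S i by (auto simp: A_def)
    next
      fix T assume T: "T \<in> {T \<in> A (Suc a). i \<in> T}"
      then have "finite (T \<inter> E)" using fin by auto
      moreover have "(T - {i}) \<inter> E = T \<inter> E - {i}" "(T - {i}) \<inter> F = T \<inter> F" using iF by auto
      ultimately show "T - {i} \<in> {S \<in> A a. i \<notin> S}"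
        using T i by (auto simp: A_def)
    qed auto
    finally show "slice E F a b (contract i p) = (\<Sum>T | T \<in> A (Suc a) \<and> i \<in> T. p T)" .
  qed
  also have "\<dots> = (\<Sum>T\<in>A (Suc a). \<Sum>i | i \<in> E \<and> i \<in> T. p T)"
    using fin(1) finA by (rule sum.swap_restrict)
  also have "\<dots> = (\<Sum>T\<in>A (Suc a). real (Suc a) * p T)"
  proof (intro sum.cong refl)
    fix T assume "T \<in> A (Suc a)"
    moreover have "{i. i \<in> E \<and> i \<in> T} = T \<inter> E" by auto
    ultimately show "(\<Sum>i | i \<in> E \<and> i \<in> T. p T) = real (Suc a) * p T" by (simp add: A_def)
  qed
  also have "\<dots> = real (Suc a) * slice E F (Suc a) b p"
    by (simp add: sum_distrib_left slice)
  finally show ?thesis .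
qed

text \<open>Each copy of an indicator vector is one use of \<open>sum_slice_contract\<close>, and
  the factors accumulate to the factorials.\<close>

lemma polar_replicate_indicator:
  assumes fin: "finite E" "finite F" and disj: "E \<inter> F = {}"
  shows "polar (E \<union> F) (replicate a (indicator E) @ replicate b (indicator F)) p
    = fact a * fact b * slice E F a b p"
proof (induction a arbitrary: p)
  case 0
  show ?case
  proof (induction b arbitrary: p)
    case 0
    have "S = {}" if "S \<subseteq> E \<union> F" "card (S \<inter> E) = 0" "card (S \<inter> F) = 0" for S
    proof -
      have "S \<inter> E = {}" "S \<inter> F = {}" using that(2,3) fin by (simp_all add: card_eq_0_iff)
      then show ?thesis using that(1) by blast
    qed
    then have eq: "{S. S \<subseteq> E \<union> F \<and> card (S \<inter> E) = 0 \<and> card (S \<inter> F) = 0} = {{}}"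
      by (intro equalityI subsetI) auto
    show ?case unfolding slice_def eq by simp
  next
    case (Suc b)
    have "polar (E \<union> F) (replicate 0 (indicator E) @ replicate (Suc b) (indicator F)) p
        = (\<Sum>i\<in>E \<union> F. indicator F i * (fact b * slice E F 0 b (contract i p)))"
      using Suc by simp
    also have "\<dots> = (\<Sum>i\<in>F. fact b * slice F E b 0 (contract i p))"
      using fin by (intro sum.mono_neutral_cong_right) (auto simp: slice_commute)
    also have "\<dots> = fact b * (real (Suc b) * slice F E (Suc b) 0 p)"
      using fin disj by (subst sum_slice_contract[symmetric]) (auto simp: sum_distrib_left)
    finally show ?case by (simp add: slice_commute[of E] mult_ac)
  qed
next
  case (Suc a)
  have "polar (E \<union> F) (replicate (Suc a) (indicator E) @ replicate b (indicator F)) p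
      = (\<Sum>i\<in>E \<union> F. indicator E i * (fact a * fact b * slice E F a b (contract i p)))"
    using Suc by simp
  also have "\<dots> = (\<Sum>i\<in>E. fact a * fact b * slice E F a b (contract i p))"
    using fin by (intro sum.mono_neutral_cong_right) auto
  also have "\<dots> = fact a * fact b * (real (Suc a) * slice E F (Suc a) b p)"
    using fin disj by (subst sum_slice_contract[symmetric]) (auto simp: sum_distrib_left)
  finally show ?case by (simp add: mult_ac)
qed

text \<open>The Alexandrov-Fenchel inequality for the indicators of \<open>E\<close> and
  \<open>F\<close>, with \<open>a\<close> and \<open>b\<close> further copies of them in the fixed
  slots. Cancelling the common part of the factorials leaves the stated constants.\<close>

lemma slice_ultra_log_concave:
  assumes fin: "finite E" "finite F" and disj: "E \<inter> F = {}"
    and p: "exchange_weights (E \<union> F) (a + b + 2) p"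
  shows "real ((a + 2) * (b + 2)) * (slice E F (a + 2) b p * slice E F a (b + 2) p)
    \<le> real ((a + 1) * (b + 1)) * (slice E F (a + 1) (b + 1) p)\<^sup>2"
proof -
  let ?E = "indicator E :: 'a \<Rightarrow> real" and ?F = "indicator F :: 'a \<Rightarrow> real"
  define us where "us = replicate a ?E @ replicate b ?F"
  have "?E # ?E # us = replicate (a + 2) ?E @ replicate b ?F" by (simp add: us_def)
  then have EE: "polar (E \<union> F) (?E # ?E # us) p = fact (a + 2) * fact b * slice E F (a + 2) b p"
    by (simp only: polar_replicate_indicator[OF fin disj])
  have "polar (E \<union> F) (replicate (Suc a) ?E @ ?F # replicate b ?F) p
      = polar (E \<union> F) (?F # replicate (Suc a) ?E @ replicate b ?F) p" by (rule polar_move)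
  also have "\<dots> = polar (E \<union> F) (?E # ?F # us) p"
    unfolding replicate_Suc append_Cons us_def by (rule polar_swap)
  finally have EF: "polar (E \<union> F) (?E # ?F # us) p
      = fact (a + 1) * fact (b + 1) * slice E F (a + 1) (b + 1) p"
    using polar_replicate_indicator[OF fin disj, of "Suc a" "Suc b" p] by simp
  have "polar (E \<union> F) (replicate a ?E @ ?F # ?F # replicate b ?F) p
      = polar (E \<union> F) (?F # replicate a ?E @ ?F # replicate b ?F) p" by (rule polar_move)
  also have "\<dots> = polar (E \<union> F) ((?F # replicate a ?E) @ ?F # replicate b ?F) p" by simp
  also have "\<dots> = polar (E \<union> F) (?F # (?F # replicate a ?E) @ replicate b ?F) p" by (rule polar_move)
  also have "\<dots> = polar (E \<union> F) (?F # ?F # us) p" unfolding us_def append_Cons ..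
  finally have FF: "polar (E \<union> F) (?F # ?F # us) p = fact a * fact (b + 2) * slice E F a (b + 2) p"
    using polar_replicate_indicator[OF fin disj, of a "Suc (Suc b)" p] by simp
  have "polar (E \<union> F) (?E # ?E # us) p * polar (E \<union> F) (?F # ?F # us) p
      \<le> (polar (E \<union> F) (?E # ?F # us) p)\<^sup>2"
  proof (rule polar_alexandrov_fenchel)
    show "exchange_weights (E \<union> F) (length us + 2) p" using p by (simp add: us_def)
  qed (use fin in \<open>auto simp: us_def\<close>)
  moreover have fact1: "fact (n + 1) = real (n + 1) * fact n"
    and fact2: "fact (n + 2) = real (n + 2) * real (n + 1) * fact n" for n by simp_all
  ultimately have "(fact a * fact b)\<^sup>2 * (real (a + 1) * real (b + 1)) *
        (real ((a + 2) * (b + 2)) * (slice E F (a + 2) b p * slice E F a (b + 2) p))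
    \<le> (fact a * fact b)\<^sup>2 * (real (a + 1) * real (b + 1)) *
        (real ((a + 1) * (b + 1)) * (slice E F (a + 1) (b + 1) p)\<^sup>2)"
    unfolding EE EF FF by (simp only: fact1 fact2 of_nat_mult power2_eq_square mult_ac)
  moreover have "0 < (fact a * fact b :: real)\<^sup>2 * (real (a + 1) * real (b + 1))" by simp
  ultimately show ?thesis by (rule mult_left_le_imp_le)
qed

section \<open>Duality\<close>

text \<open>\<open>X - S\<close> sees only the part of \<open>S\<close> inside \<open>X\<close>, so
  sets not contained in \<open>X\<close> are given weight 0 explicitly.\<close>

definition dual :: "'a set \<Rightarrow> ('a set \<Rightarrow> real) \<Rightarrow> 'a set \<Rightarrow> real" where
  "dual X p S = (if S \<subseteq> X then p (X - S) else 0)"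

text \<open>An element of \<open>S - T\<close> lies in \<open>X - T\<close> but not in
  \<open>X - S\<close>, so the exchange is applied to the complements with the roles of
  \<open>S\<close> and \<open>T\<close> reversed.\<close>

lemma exchange_weights_dual:
  assumes X: "finite X" and p: "exchange_weights X r p"
  shows "exchange_weights X (card X - r) (dual X p)"
  unfolding exchange_weights_def
proof (intro conjI allI ballI impI)
  show "0 \<le> dual X p S" for S using exchange_weights_nonneg[OF p] by (simp add: dual_def)
  fix S assume "0 < dual X p S"
  then have S: "S \<subseteq> X" "0 < p (X - S)" by (auto simp: dual_def split: if_splits)
  then show "S \<subseteq> X" by simp
  have "card (X - S) = r" using exchange_weights_support[OF p S(2)] by simp
  moreover have "card X = card (X - S) + card S"
    using S X by (metis card_Diff_subset card_mono finite_subset le_add_diff_inverse2)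
  ultimately show "card S = card X - r" by simp
  fix T s assume s: "s \<in> S - T" and "0 < dual X p T"
  then have T: "T \<subseteq> X" "0 < p (X - T)" by (auto simp: dual_def split: if_splits)
  have "s \<in> (X - T) - (X - S)" using s S by auto
  then obtain t where t: "t \<in> (X - S) - (X - T)" and
    le: "p (X - T) * p (X - S) \<le> p (insert t (X - T - {s})) * p (insert s (X - S - {t}))"
    using exchange_weights_exchange[OF p _ T(2) S(2)] by blast
  have tTS: "t \<in> T - S" using t T by auto
  then have "X - insert t (S - {s}) = insert s (X - S - {t})"
    "X - insert s (T - {t}) = insert t (X - T - {s})"
    using s S T by auto
  moreover have "insert t (S - {s}) \<subseteq> X" "insert s (T - {t}) \<subseteq> X" using s S T tTS by auto
  ultimately have "dual X p S * dual X p T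
      \<le> dual X p (insert t (S - {s})) * dual X p (insert s (T - {t}))"
    using le S T by (simp add: dual_def mult.commute)
  then show "\<exists>t\<in>T - S. dual X p S * dual X p T
      \<le> dual X p (insert t (S - {s})) * dual X p (insert s (T - {t}))"
    using tTS by blast
qed

lemma slice_dual:
  assumes fin: "finite E" "finite F" and a: "a \<le> card E" and b: "b \<le> card F"
  shows "slice F E (card F - b) (card E - a) (dual (E \<union> F) p) = slice E F a b p"
proof -
  have "card (((E \<union> F) - S) \<inter> E) = card E - card (S \<inter> E)"
    "card (((E \<union> F) - S) \<inter> F) = card F - card (S \<inter> F)" for S
  proof -
    have "((E \<union> F) - S) \<inter> E = E - S \<inter> E" "((E \<union> F) - S) \<inter> F = F - S \<inter> F" by auto
    then show "card (((E \<union> F) - S) \<inter> E) = card E - card (S \<inter> E)"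
      "card (((E \<union> F) - S) \<inter> F) = card F - card (S \<inter> F)"
      using fin by (simp_all add: card_Diff_subset)
  qed
  note compl = this
  have le: "card (S \<inter> E) \<le> card E" "card (S \<inter> F) \<le> card F" for S
    using fin by (auto intro: card_mono)
  show ?thesis
    unfolding slice_def
  proof (rule sum.reindex_bij_witness[of _ "\<lambda>S. E \<union> F - S" "\<lambda>S. E \<union> F - S"])
    fix S assume S: "S \<in> {S. S \<subseteq> F \<union> E \<and> card (S \<inter> F) = card F - b \<and> card (S \<inter> E) = card E - a}"
    then show "E \<union> F - (E \<union> F - S) = S" "p (E \<union> F - S) = dual (E \<union> F) p S"
      by (auto simp: dual_def)
    show "E \<union> F - S \<in> {S. S \<subseteq> E \<union> F \<and> card (S \<inter> E) = a \<and> card (S \<inter> F) = b}"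
      using S a b by (auto simp: compl)
  next
    fix S assume S: "S \<in> {S. S \<subseteq> E \<union> F \<and> card (S \<inter> E) = a \<and> card (S \<inter> F) = b}"
    then show "E \<union> F - (E \<union> F - S) = S" by auto
    show "E \<union> F - S \<in> {S. S \<subseteq> F \<union> E \<and> card (S \<inter> F) = card F - b \<and> card (S \<inter> E) = card E - a}"
      using S by (auto simp: compl)
  qed
qed

section \<open>From valuated bimatroids to exchange weights\<close>

text \<open>For \<open>q \<le> 1\<close> the power is antitone in the exponent, which reverses the
  additive inequality. Finiteness of \<open>a + b\<close> forces \<open>c\<close> and
  \<open>d\<close> to be finite.\<close>

lemma qpow_mult_mono:
  assumes q: "0 < q" "q \<le> 1"
    and fin: "a \<noteq> \<infinity>" "b \<noteq> \<infinity>" and ninf: "a \<noteq> -\<infinity>" "b \<noteq> -\<infinity>" "c \<noteq> -\<infinity>" "d \<noteq> -\<infinity>"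
    and le: "c + d \<le> a + b"
  shows "qpow q a * qpow q b \<le> qpow q c * qpow q d"
proof -
  obtain a' b' where ab: "a = ereal a'" "b = ereal b'" using fin ninf by (cases a; cases b) auto
  obtain c' d' where cd: "c = ereal c'" "d = ereal d'"
    using le ninf ab by (cases c; cases d) auto
  have "c' + d' \<le> a' + b'" using le ab cd by simp
  then have "q powr (a' + b') \<le> q powr (c' + d')" using q by (intro powr_mono') auto
  then show ?thesis by (simp add: qpow_def ab cd powr_add)
qed

definition bimatroid_weight ::
    "real \<Rightarrow> 'a set \<Rightarrow> 'a set \<Rightarrow> ('a set \<Rightarrow> 'a set \<Rightarrow> ereal) \<Rightarrow> 'a set \<Rightarrow> real" where
  "bimatroid_weight q E F \<mu> S =
     (if S \<subseteq> E \<union> F \<and> card S = card E then qpow q (\<mu> (E - S) (S \<inter> F)) else 0)"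

lemma exchange_weights_bimatroid:
  assumes fin: "finite E" "finite F" and \<mu>: "valuated_bimatroid G E F \<mu>" and q: "0 < q" "q \<le> 1"
  shows "exchange_weights (E \<union> F) (card E) (bimatroid_weight q E F \<mu>)" (is "exchange_weights ?X ?r ?p")
  unfolding exchange_weights_def
proof (intro conjI allI ballI impI)
  define \<nu> where "\<nu> = (\<lambda>S. \<mu> (E - S) (S \<inter> F))"
  have "valuated_matroid G ?X ?r \<nu>" using \<mu> by (simp add: valuated_bimatroid_def \<nu>_def)
  note vm = this[unfolded valuated_matroid_def]
  \<comment> \<open>Values in \<open>Gbar G\<close> are real or \<open>\<infinity>\<close>. At
    \<open>-\<infinity>\<close> the value of \<open>qpow\<close> would be meaningless.\<close>
  then have ninf: "\<nu> S \<noteq> -\<infinity>" if "S \<subseteq> ?X" "card S = ?r" for S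
    using vm[THEN conjunct1, rule_format, of S] that by (auto simp: Gbar_def)
  have exch: "\<exists>t\<in>T - S. \<nu> S + \<nu> T \<ge> \<nu> (S - {s} \<union> {t}) + \<nu> (T - {t} \<union> {s})"
    if "S \<subseteq> ?X" "card S = ?r" "T \<subseteq> ?X" "card T = ?r" "s \<in> S - T" for S T s
    by (rule vm[THEN conjunct2, THEN conjunct2, rule_format]) (use that in simp)
  have p: "?p S = (if S \<subseteq> ?X \<and> card S = ?r then qpow q (\<nu> S) else 0)" for S
    by (simp add: bimatroid_weight_def \<nu>_def)
  show "0 \<le> ?p S" for S by (simp add: bimatroid_weight_def qpow_def)
  fix S assume "0 < ?p S"
  then have S: "S \<subseteq> ?X" "card S = ?r" "\<nu> S \<noteq> \<infinity>" unfolding p by (auto simp: qpow_def split: if_splits)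
  then show "S \<subseteq> ?X" "card S = ?r" by auto
  fix T s assume s: "s \<in> S - T" and "0 < ?p T"
  then have T: "T \<subseteq> ?X" "card T = ?r" "\<nu> T \<noteq> \<infinity>" unfolding p by (auto simp: qpow_def split: if_splits)
  obtain t where t: "t \<in> T - S" and le: "\<nu> S + \<nu> T \<ge> \<nu> (S - {s} \<union> {t}) + \<nu> (T - {t} \<union> {s})"
    using exch[OF S(1,2) T(1,2) s] by blast
  have "finite S" "finite T" using S T fin finite_subset by blast+
  then have "card (insert t (S - {s})) = card S" "card (insert s (T - {t})) = card T"
    using s t by (simp_all add: card_Suc_Diff1 del: card_Diff_insert)
  then have card: "card (insert t (S - {s})) = ?r" "card (insert s (T - {t})) = ?r"
    using S(2) T(2) by simp_all
  have sub: "insert t (S - {s}) \<subseteq> ?X" "insert s (T - {t}) \<subseteq> ?X"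
    using s t S(1) T(1) by auto
  note new = card sub
  have "qpow q (\<nu> S) * qpow q (\<nu> T) \<le> qpow q (\<nu> (insert t (S - {s}))) * qpow q (\<nu> (insert s (T - {t})))"
  proof (rule qpow_mult_mono[OF q S(3) T(3)])
    show "\<nu> (insert t (S - {s})) + \<nu> (insert s (T - {t})) \<le> \<nu> S + \<nu> T" using le by simp
  qed (use ninf S T new in blast)+
  then show "\<exists>t\<in>T - S. ?p S * ?p T \<le> ?p (insert t (S - {s})) * ?p (insert s (T - {t}))"
    unfolding p using t S T new by (intro bexI[of _ t]) simp_all
qed

text \<open>The minor \<open>(I, J)\<close> corresponds to the set \<open>(E - I) \<union> J\<close>
  of size \<open>card E\<close>, with inverse \<open>S\<close> to
  \<open>(E - S, S \<inter> F)\<close>. The bound on \<open>k\<close> keeps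
  \<open>card E - k\<close> exact.\<close>

lemma R_eq_slice:
  assumes fin: "finite E" "finite F" and disj: "E \<inter> F = {}" and k: "k \<le> card E"
  shows "R q E F \<mu> k = slice E F (card E - k) k (bimatroid_weight q E F \<mu>)"
  unfolding R_def slice_def
proof (rule sum.reindex_bij_witness[of _ "\<lambda>S. (E - S, S \<inter> F)" "\<lambda>(I, J). (E - I) \<union> J"])
  fix z assume "z \<in> {(I, J). I \<subseteq> E \<and> J \<subseteq> F \<and> card I = k \<and> card J = k}"
  then obtain I J where z: "z = (I, J)" and IJ: "I \<subseteq> E" "J \<subseteq> F" "card I = k" "card J = k" by auto
  have eqs: "E - (E - I \<union> J) = I" "(E - I \<union> J) \<inter> F = J" "(E - I \<union> J) \<inter> E = E - I"
    using IJ disj by auto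
  have fin': "finite I" "finite J" using IJ fin finite_subset by auto
  have cE: "card (E - I) = card E - k" using IJ fin' by (simp add: card_Diff_subset)
  have "card (E - I \<union> J) = card E"
    using IJ fin fin' disj k cE by (subst card_Un_disjoint) auto
  then show "bimatroid_weight q E F \<mu> (case z of (I, J) \<Rightarrow> E - I \<union> J) = (case z of (I, J) \<Rightarrow> qpow q (\<mu> I J))"
    using IJ by (auto simp: z bimatroid_weight_def eqs)
  show "(case z of (I, J) \<Rightarrow> E - I \<union> J) \<in> {S. S \<subseteq> E \<union> F \<and> card (S \<inter> E) = card E - k \<and> card (S \<inter> F) = k}"
    using IJ cE by (auto simp: z eqs)
  show "(E - (case z of (I, J) \<Rightarrow> E - I \<union> J), (case z of (I, J) \<Rightarrow> E - I \<union> J) \<inter> F) = z"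
    by (simp add: z eqs)
next
  fix S assume S: "S \<in> {S. S \<subseteq> E \<union> F \<and> card (S \<inter> E) = card E - k \<and> card (S \<inter> F) = k}"
  then show "(case (E - S, S \<inter> F) of (I, J) \<Rightarrow> E - I \<union> J) = S" using disj by auto
  have "card (E - S) = card E - card (S \<inter> E)"
    using fin by (metis Diff_Int2 Int_commute card_Diff_subset_Int finite_Int)
  then show "(E - S, S \<inter> F) \<in> {(I, J). I \<subseteq> E \<and> J \<subseteq> F \<and> card I = k \<and> card J = k}"
    using S k by auto
qed

lemma R_eq_zero:
  assumes "finite E" "finite F" "min (card E) (card F) < k"
  shows "R q E F \<mu> k = 0"
proof -
  have "\<not> (I \<subseteq> E \<and> J \<subseteq> F \<and> card I = k \<and> card J = k)" for I J
    using assms card_mono[of E I] card_mono[of F J] by auto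
  then have "{(I, J). I \<subseteq> E \<and> J \<subseteq> F \<and> card I = k \<and> card J = k} = {}" by simp
  then show ?thesis unfolding R_def by (simp only: sum.empty)
qed

section \<open>Ultra log-concavity of the sums of minors\<close>

theorem theoremC:
  fixes G :: "real set" and E F :: "'a set" and \<mu> :: "'a set \<Rightarrow> 'a set \<Rightarrow> ereal"
    and q :: real and N k :: nat
  assumes "additive_subgroup G"
    and "finite E" and "finite F" and "E \<inter> F = {}"
    and "valuated_bimatroid G E F \<mu>"
    and "0 < q" and "q \<le> 1"
    and "N \<ge> min (card E) (card F)"
    and "k \<ge> 1"
  shows "(R q E F \<mu> k)\<^sup>2 / (real (N choose k))\<^sup>2 \<ge>
         (R q E F \<mu> (k + 1) / real (N choose (k + 1))) * (R q E F \<mu> (k - 1) / real (N choose (k - 1)))"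
proof (cases "k + 1 \<le> min (card E) (card F)")
  case False
  then have "R q E F \<mu> (k + 1) = 0" using assms by (intro R_eq_zero) auto
  then show ?thesis by simp
next
  case True
  note fin = assms(2,3) and disj = assms(4)
  let ?R = "R q E F \<mu>"
  define p where "p = bimatroid_weight q E F \<mu>"
  have p: "exchange_weights (E \<union> F) (card E) p"
    unfolding p_def using assms by (intro exchange_weights_bimatroid)
  have Rp: "?R j = slice E F (card E - j) j p" if "j \<le> k + 1" for j
    unfolding p_def using that True by (intro R_eq_slice fin disj) auto
  \<comment> \<open>The dual weights have rank \<open>card F\<close> and exchange the roles of
    \<open>E\<close> and \<open>F\<close>, so the same sums \<open>?R j\<close> become slices for
    the parameter \<open>card F\<close>.\<close>
  have dual: "exchange_weights (F \<union> E) (card F) (dual (E \<union> F) p)"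
    using exchange_weights_dual[OF _ p] fin disj by (simp add: card_Un_disjoint Un_commute)
  have Rd: "?R j = slice F E (card F - j) j (dual (E \<union> F) p)" if "j \<le> k + 1" for j
    using slice_dual[OF fin, of "card E - j" j p] Rp[OF that] that True by simp
  have nn: "0 \<le> ?R j" for j
    unfolding R_def by (intro sum_nonneg) (auto simp: qpow_def)
  define b where "b = k - 1"
  have k: "k = b + 1" using assms(9) by (simp add: b_def)
  \<comment> \<open>\<open>M\<close> is the best parameter. Writing \<open>M = a + b + 2\<close> and
    \<open>k = b + 1\<close> matches the indices of \<open>slice_ultra_log_concave\<close>.\<close>
  define M where "M = min (card E) (card F)"
  define a where "a = M - k - 1"
  have M: "M = a + b + 2" using True k by (auto simp: a_def M_def)
  have ulc: "real ((a + 2) * (b + 2)) * (?R b * ?R (b + 2)) \<le> real ((a + 1) * (b + 1)) * (?R (b + 1))\<^sup>2"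
  proof (cases "card E \<le> card F")
    case True
    then have cE: "card E = a + b + 2" using M by (simp add: M_def)
    show ?thesis using slice_ultra_log_concave[OF fin disj, of a b p] p Rp[of b] Rp[of "b + 1"] Rp[of "b + 2"]
      by (simp add: cE k)
  next
    case False
    then have cF: "card F = a + b + 2" using M by (simp add: M_def)
    show ?thesis using slice_ultra_log_concave[OF fin(2,1), of a b "dual (E \<union> F) p"] disj dual
        Rd[of b] Rd[of "b + 1"] Rd[of "b + 2"]
      by (simp add: cF k Int_commute)
  qed
  define c where "c = N - M"
  have N: "N = c + a + b + 2" using assms(8) M by (simp add: c_def M_def)
  have N': "real (c + a + 2) * real (b + 2) * (?R b * ?R (b + 2)) \<le> real (c + a + 1) * real (b + 1) * (?R (b + 1))\<^sup>2"
  proof -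
    have "real (a + 1) * (real (c + a + 2) * real (b + 2) * (?R b * ?R (b + 2)))
        \<le> real (c + a + 1) * (real ((a + 2) * (b + 2)) * (?R b * ?R (b + 2)))"
    proof -
      \<comment> \<open>Passing from \<open>M\<close> to \<open>N = M + c\<close> only weakens the
        inequality: the two sides here differ by exactly \<open>c\<close>.\<close>
      have "real (a + 1) * real (c + a + 2) \<le> real (c + a + 1) * real (a + 2)"
        by (simp add: algebra_simps)
      then have "(real (a + 1) * real (c + a + 2)) * (real (b + 2) * (?R b * ?R (b + 2)))
          \<le> (real (c + a + 1) * real (a + 2)) * (real (b + 2) * (?R b * ?R (b + 2)))"
        using nn by (intro mult_right_mono) auto
      then show ?thesis by (simp only: of_nat_mult mult_ac)
    qed
    also have "\<dots> \<le> real (c + a + 1) * (real ((a + 1) * (b + 1)) * (?R (b + 1))\<^sup>2)"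
      by (rule mult_left_mono[OF ulc]) simp
    also have "\<dots> = real (a + 1) * (real (c + a + 1) * real (b + 1) * (?R (b + 1))\<^sup>2)"
      by (simp only: of_nat_mult mult_ac)
    finally show ?thesis by (rule mult_left_le_imp_le) simp
  qed
  define B where "B = real (N choose (b + 1))"
  \<comment> \<open>Ratios of neighbouring binomial coefficients express both outer ones through the
    middle one, \<open>B\<close>.\<close>
  have absorb: "Suc j * (N choose Suc j) = (N - j) * (N choose j)" for j
    using binomial_absorb_comp[of N j] binomial_absorption[of j N] by simp
  have "(b + 2) * (N choose (b + 2)) = (c + a + 1) * (N choose (b + 1))"
    "(b + 1) * (N choose (b + 1)) = (c + a + 2) * (N choose b)"
    using absorb[of "b + 1"] absorb[of b] N by (simp_all del: binomial_Suc_Suc mult_Suc)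
  then have "real (b + 2) * real (N choose (b + 2)) = real (c + a + 1) * B"
    "real (b + 1) * B = real (c + a + 2) * real (N choose b)"
    unfolding B_def of_nat_mult[symmetric] by (simp_all only:)
  then have B2: "real (N choose (b + 2)) = real (c + a + 1) * B / real (b + 2)"
    and B0: "real (N choose b) = real (b + 1) * B / real (c + a + 2)"
    by (simp_all add: field_simps)
  have Bpos: "0 < B" using N by (simp add: B_def zero_less_binomial_iff del: binomial_Suc_Suc)
  have "?R (b + 2) / real (N choose (b + 2)) * (?R b / real (N choose b))
      = (real (c + a + 2) * real (b + 2) * (?R b * ?R (b + 2))) / (real (c + a + 1) * real (b + 1) * B\<^sup>2)"
    unfolding B2 B0 by (simp add: power2_eq_square mult_ac)
  also have "\<dots> \<le> (real (c + a + 1) * real (b + 1) * (?R (b + 1))\<^sup>2) / (real (c + a + 1) * real (b + 1) * B\<^sup>2)"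
    using Bpos by (intro divide_right_mono[OF N']) simp
  also have "\<dots> = (?R (b + 1))\<^sup>2 / B\<^sup>2" by simp
  finally show ?thesis by (simp add: k B_def)
qed

end
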